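(* Let $G$ be a connected graph and $U\subseteq V(G)$. Then $U$ is normally spanned in $G$ if and only if every $U$-rooted minor of $G$ with countable branch sets has countable colouring number.
   Context: A rooted tree $T\subseteq G$ (tree order: $x\le y$ iff $x$ lies on the root–$y$ path in $T$) is normal in $G$ if for every $T$-path in $G$ (a path with at least one edge, both endvertices in $T$, edges and inner vertices outside $T$) the endvertices are comparable. $U$ is normally spanned in $G$ if some normal tree in $G$ contains $U$. A minor is given by disjoint connected branch sets $X_v\subseteq V(G)$; it is $U$-rooted if every branch set contains a vertex of $U$, and has countable branch sets if every $X_v$ is countable. A graph has countable colouring number if its vertices admit a well-order in which each vertex is preceded by only finitely many of its neighbours. *)

theory Defs
  imports Main "HOL-Library.Countable_Set"
begin

definition graph :: "'a set \<Rightarrow> ('a \<Rightarrow> 'a \<Rightarrow> bool) \<Rightarrow> bool" where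
  "graph V adj \<longleftrightarrow> (\<forall>x y. adj x y \<longrightarrow> x \<in> V \<and> y \<in> V \<and> x \<noteq> y \<and> adj y x)"

definition gpath :: "'a set \<Rightarrow> ('a \<Rightarrow> 'a \<Rightarrow> bool) \<Rightarrow> 'a list \<Rightarrow> bool" where
  "gpath V adj p \<longleftrightarrow> p \<noteq> [] \<and> distinct p \<and> set p \<subseteq> V \<and>
     (\<forall>i. Suc i < length p \<longrightarrow> adj (p ! i) (p ! Suc i))"

definition connected_in :: "'a set \<Rightarrow> ('a \<Rightarrow> 'a \<Rightarrow> bool) \<Rightarrow> 'a set \<Rightarrow> bool" where
  "connected_in V adj X \<longleftrightarrow> X \<noteq> {} \<and> X \<subseteq> V \<and>
     (\<forall>x\<in>X. \<forall>y\<in>X. \<exists>p. gpath X adj p \<and> hd p = x \<and> last p = y)"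

definition is_tree :: "'a set \<Rightarrow> ('a \<Rightarrow> 'a \<Rightarrow> bool) \<Rightarrow> bool" where
  "is_tree VT adjT \<longleftrightarrow> graph VT adjT \<and> VT \<noteq> {} \<and>
     (\<forall>x\<in>VT. \<forall>y\<in>VT. \<exists>!p. gpath VT adjT p \<and> hd p = x \<and> last p = y)"

definition subtree :: "'a set \<Rightarrow> ('a \<Rightarrow> 'a \<Rightarrow> bool) \<Rightarrow> 'a set \<Rightarrow> ('a \<Rightarrow> 'a \<Rightarrow> bool) \<Rightarrow> bool" where
  "subtree V adj VT adjT \<longleftrightarrow> VT \<subseteq> V \<and> (\<forall>x y. adjT x y \<longrightarrow> adj x y) \<and> is_tree VT adjT"

definition tree_le :: "'a set \<Rightarrow> ('a \<Rightarrow> 'a \<Rightarrow> bool) \<Rightarrow> 'a \<Rightarrow> 'a \<Rightarrow> 'a \<Rightarrow> bool" where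
  "tree_le VT adjT r x y \<longleftrightarrow> (\<exists>p. gpath VT adjT p \<and> hd p = r \<and> last p = y \<and> x \<in> set p)"

definition tpath :: "'a set \<Rightarrow> ('a \<Rightarrow> 'a \<Rightarrow> bool) \<Rightarrow> 'a set \<Rightarrow> ('a \<Rightarrow> 'a \<Rightarrow> bool) \<Rightarrow> 'a list \<Rightarrow> bool" where
  "tpath V adj VT adjT p \<longleftrightarrow> gpath V adj p \<and> 2 \<le> length p \<and> hd p \<in> VT \<and> last p \<in> VT \<and>
     (\<forall>i. 0 < i \<and> Suc i < length p \<longrightarrow> p ! i \<notin> VT) \<and>
     (\<forall>i. Suc i < length p \<longrightarrow> \<not> adjT (p ! i) (p ! Suc i))"

definition normal_tree :: "'a set \<Rightarrow> ('a \<Rightarrow> 'a \<Rightarrow> bool) \<Rightarrow> 'a set \<Rightarrow> ('a \<Rightarrow> 'a \<Rightarrow> bool) \<Rightarrow> 'a \<Rightarrow> bool" where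
  "normal_tree V adj VT adjT r \<longleftrightarrow> subtree V adj VT adjT \<and> r \<in> VT \<and>
     (\<forall>p. tpath V adj VT adjT p \<longrightarrow>
        tree_le VT adjT r (hd p) (last p) \<or> tree_le VT adjT r (last p) (hd p))"

definition normally_spanned :: "'a set \<Rightarrow> ('a \<Rightarrow> 'a \<Rightarrow> bool) \<Rightarrow> 'a set \<Rightarrow> bool" where
  "normally_spanned V adj U \<longleftrightarrow> (\<exists>VT adjT r. normal_tree V adj VT adjT r \<and> U \<subseteq> VT)"

text \<open>A minor H of G, with the vertices of H identified with their branch sets:
HV is a family of pairwise disjoint connected vertex sets of G, and every edge
XY of H is witnessed by an X--Y edge of G.\<close>
definition minor_of :: "'a set \<Rightarrow> ('a \<Rightarrow> 'a \<Rightarrow> bool) \<Rightarrow> 'a set set \<Rightarrow> ('a set \<Rightarrow> 'a set \<Rightarrow> bool) \<Rightarrow> bool" where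
  "minor_of V adj HV adjH \<longleftrightarrow> graph HV adjH \<and>
     (\<forall>X\<in>HV. connected_in V adj X) \<and>
     (\<forall>X\<in>HV. \<forall>Y\<in>HV. X \<noteq> Y \<longrightarrow> X \<inter> Y = {}) \<and>
     (\<forall>X Y. adjH X Y \<longrightarrow> (\<exists>x\<in>X. \<exists>y\<in>Y. adj x y))"

definition rooted_minor :: "'a set \<Rightarrow> 'a set set \<Rightarrow> bool" where
  "rooted_minor U HV \<longleftrightarrow> (\<forall>X\<in>HV. X \<inter> U \<noteq> {})"

definition countable_branch_sets :: "'a set set \<Rightarrow> bool" where
  "countable_branch_sets HV \<longleftrightarrow> (\<forall>X\<in>HV. countable X)"

definition countable_colouring_number :: "'b set \<Rightarrow> ('b \<Rightarrow> 'b \<Rightarrow> bool) \<Rightarrow> bool" where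
  "countable_colouring_number V adj \<longleftrightarrow>
     (\<exists>r. well_order_on V r \<and> (\<forall>x\<in>V. finite {y. adj y x \<and> y \<noteq> x \<and> (y, x) \<in> r}))"

end

theory Submission
  imports Defs "HOL-Library.Sublist"
begin

text \<open>
If a normal tree \<open>T\<close> contains \<open>U\<close>, then every connected set meeting \<open>T\<close> has a least element in
the tree order, and adjacent branch sets have comparable least elements. Ordering the branch sets by
the height of these elements leaves only finitely many neighbours before each of them.

For the converse, the central notion is a finitary closure operator \<open>K\<close> with countable values such
that every component of \<open>G - M\<close> meeting \<open>U\<close> has only finitely many neighbours in \<open>M\<close>, for each
\<open>K\<close>-closed \<open>M\<close>, however large. From \<open>K\<close> a normal tree is grown in which the path towards any
\<open>u \<in> U\<close> runs, inside the current component, to ever new elements of the \<open>K\<close>-closure of what it has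
passed. Were \<open>u\<close> never reached, the component of \<open>u\<close> outside that closure would have only finitely
many neighbours in it, hence would be one of the current components, which nevertheless contains
the next vertex of the path.

The operator \<open>K\<close> is obtained by iterating a closure that defeats a single choice function \<open>\<delta>\<close>.
Along a well-order, \<open>\<delta>\<close> yields a sequence of disjoint countable sets \<open>B j\<close>, each of them connected
and containing \<open>\<delta> j\<close>, rooted, and attached to infinitely many earlier vertices if its component is.
These sets form a rooted minor, whose colouring order closes off the infinite attachments.
\<close>

section \<open>Connected sets and components\<close>

lemma gpath_single: "gpath S adj [x] \<longleftrightarrow> x \<in> S"
  by (auto simp: gpath_def)

lemma gpath_Cons:
  "gpath S adj (x # y # p) \<longleftrightarrow> x \<in> S \<and> adj x y \<and> x \<notin> set (y # p) \<and> gpath S adj (y # p)"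
proof -
  have "(\<forall>i. Suc i < length (x # y # p) \<longrightarrow> adj ((x # y # p) ! i) ((x # y # p) ! Suc i)) \<longleftrightarrow>
    adj x y \<and> (\<forall>i. Suc i < length (y # p) \<longrightarrow> adj ((y # p) ! i) ((y # p) ! Suc i))"
    (is "?L \<longleftrightarrow> ?R")
  proof
    assume L: ?L
    have "adj x y" using L[rule_format, of 0] by simp
    moreover have "adj ((y # p) ! i) ((y # p) ! Suc i)" if "Suc i < length (y # p)" for i
      using L[rule_format, of "Suc i"] that by simp
    ultimately show ?R by blast
  next
    assume R: ?R
    show ?L
    proof (intro allI impI)
      fix i assume "Suc i < length (x # y # p)"
      then show "adj ((x # y # p) ! i) ((x # y # p) ! Suc i)"
        using R by (cases i) auto
    qed
  qed
  then show ?thesis by (auto simp: gpath_def)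
qed

lemma gpath_mono: "gpath S adj p \<Longrightarrow> S \<subseteq> S' \<Longrightarrow> gpath S' adj p"
  by (auto simp: gpath_def)

lemma gpath_append:
  assumes "gpath S adj p" "gpath S adj q" "adj (last p) (hd q)" "set p \<inter> set q = {}"
  shows "gpath S adj (p @ q)"
  using assms
proof (induction p rule: induct_list012)
  case 1 then show ?case by (simp add: gpath_def)
next
  case (2 x)
  then show ?case by (cases q) (auto simp: gpath_Cons gpath_single gpath_def[of _ _ "[]"])
next
  case (3 x y p)
  then show ?case by (auto simp: gpath_Cons)
qed

lemma gpath_appendD1: "gpath S adj (p @ q) \<Longrightarrow> p \<noteq> [] \<Longrightarrow> gpath S adj p"
proof (induction p rule: induct_list012)
  case (2 x) then show ?case by (auto simp: gpath_def)
next
  case (3 x y p) then show ?case by (auto simp: gpath_Cons)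
qed simp

lemma gpath_appendD2: "gpath S adj (p @ q) \<Longrightarrow> q \<noteq> [] \<Longrightarrow> gpath S adj q"
proof (induction p)
  case (Cons x p)
  then show ?case by (cases "p @ q") (auto simp: gpath_Cons)
qed simp

definition edge_in :: "('a \<Rightarrow> 'a \<Rightarrow> bool) \<Rightarrow> 'a set \<Rightarrow> 'a \<Rightarrow> 'a \<Rightarrow> bool" where
  "edge_in adj S x y \<longleftrightarrow> adj x y \<and> x \<in> S \<and> y \<in> S"

lemma reach_mono: "(edge_in adj S)\<^sup>*\<^sup>* x y \<Longrightarrow> S \<subseteq> S' \<Longrightarrow> (edge_in adj S')\<^sup>*\<^sup>* x y"
  by (erule rtranclp_mono[THEN predicate2D, rotated]) (auto simp: edge_in_def)

lemma gpath_reach: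
  "gpath S adj p \<Longrightarrow> (edge_in adj S)\<^sup>*\<^sup>* (hd p) (last p)"
proof (induction p rule: induct_list012)
  case (3 x y p)
  then have "edge_in adj S x y" by (auto simp: gpath_Cons edge_in_def gpath_def)
  with 3 show ?case by (auto simp: gpath_Cons intro: converse_rtranclp_into_rtranclp)
qed (auto simp: gpath_def)

lemma reach_gpath:
  assumes "(edge_in adj S)\<^sup>*\<^sup>* x y" "x \<in> S"
  obtains p where "gpath S adj p" "hd p = x" "last p = y"
proof -
  have "\<exists>p. gpath S adj p \<and> hd p = x \<and> last p = y"
    using assms
  proof (induction rule: rtranclp_induct)
    case base
    then show ?case by (intro exI[of _ "[x]"]) (simp add: gpath_single)
  next
    case (step y z)
    then obtain p where p: "gpath S adj p" "hd p = x" "last p = y" by auto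
    then have "p \<noteq> []" by (auto simp: gpath_def)
    have z: "z \<in> S" "adj y z" using step.hyps by (auto simp: edge_in_def)
    show ?case
    proof (cases "z \<in> set p")
      case True
      then obtain q q' where q: "p = q @ z # q'" by (meson split_list)
      then have "gpath S adj (q @ [z])" using p(1) gpath_appendD1[of S adj "q @ [z]" q'] by simp
      moreover have "hd (q @ [z]) = x" using q p(2) by (cases q) auto
      ultimately show ?thesis by (metis last_snoc)
    next
      case False
      then have "gpath S adj (p @ [z])" using p z by (intro gpath_append) (auto simp: gpath_single)
      then show ?thesis using p \<open>p \<noteq> []\<close> by (intro exI[of _ "p @ [z]"]) auto
    qed
  qed
  then show thesis using that by blast
qed

text \<open>Reachability replaces paths here, so that unions and enlargements need no care about
  repeated vertices; \<open>connected_in_iff\<close> relates this notion to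
  \<open>connected_in\<close>.\<close>

definition conn :: "('a \<Rightarrow> 'a \<Rightarrow> bool) \<Rightarrow> 'a set \<Rightarrow> bool" where
  "conn adj X \<longleftrightarrow> X \<noteq> {} \<and> (\<forall>x\<in>X. \<forall>y\<in>X. (edge_in adj X)\<^sup>*\<^sup>* x y)"

lemma connected_in_iff: "connected_in V adj X \<longleftrightarrow> X \<subseteq> V \<and> conn adj X"
proof -
  have "(\<exists>p. gpath X adj p \<and> hd p = x \<and> last p = y) \<longleftrightarrow> (edge_in adj X)\<^sup>*\<^sup>* x y" if "x \<in> X" for x y
    using that by (meson gpath_reach reach_gpath)
  then show ?thesis by (auto simp: connected_in_def conn_def)
qed

text \<open>For \<open>x\<close> outside \<open>S\<close> this is the junk singleton of
  \<open>x\<close>, which explains the hypotheses \<open>x \<in> S\<close> below.\<close>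

definition component :: "('a \<Rightarrow> 'a \<Rightarrow> bool) \<Rightarrow> 'a set \<Rightarrow> 'a \<Rightarrow> 'a set" where
  "component adj S x = {y. (edge_in adj S)\<^sup>*\<^sup>* x y}"

lemma component_refl [simp]: "x \<in> component adj S x"
  by (simp add: component_def)

lemma component_subset: "x \<in> S \<Longrightarrow> component adj S x \<subseteq> S"
proof
  fix y assume "x \<in> S" "y \<in> component adj S x"
  then have "(edge_in adj S)\<^sup>*\<^sup>* x y" by (simp add: component_def)
  then show "y \<in> S" using \<open>x \<in> S\<close> by induction (auto simp: edge_in_def)
qed

lemma component_step: "y \<in> component adj S x \<Longrightarrow> adj y z \<Longrightarrow> z \<in> S \<Longrightarrow> x \<in> S \<Longrightarrow> z \<in> component adj S x"
  using component_subset[of x S adj] rtranclp.rtrancl_into_rtrancl[of "edge_in adj S" x y z]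
  by (auto simp: component_def edge_in_def)

lemma component_least:
  assumes "x \<in> C" "\<And>y z. y \<in> C \<Longrightarrow> adj y z \<Longrightarrow> z \<in> S \<Longrightarrow> z \<in> C"
  shows "component adj S x \<subseteq> C"
proof
  fix y assume "y \<in> component adj S x"
  then have "(edge_in adj S)\<^sup>*\<^sup>* x y" by (simp add: component_def)
  then show "y \<in> C" using assms by induction (auto simp: edge_in_def)
qed

lemma conn_subset_component: "conn adj D \<Longrightarrow> D \<subseteq> S \<Longrightarrow> x \<in> D \<Longrightarrow> D \<subseteq> component adj S x"
  by (auto simp: conn_def component_def dest: reach_mono)

lemma component_mono: "S \<subseteq> S' \<Longrightarrow> component adj S x \<subseteq> component adj S' x"
  by (auto simp: component_def dest: reach_mono)

context
  fixes adj :: "'a \<Rightarrow> 'a \<Rightarrow> bool"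
  assumes sym: "\<And>x y. adj x y \<Longrightarrow> adj y x"
begin

lemma reach_sym: "(edge_in adj S)\<^sup>*\<^sup>* x y \<Longrightarrow> (edge_in adj S)\<^sup>*\<^sup>* y x"
  by (induction rule: rtranclp_induct)
    (auto simp: edge_in_def intro: converse_rtranclp_into_rtranclp sym)

lemma component_eq: "y \<in> component adj S x \<Longrightarrow> component adj S y = component adj S x"
  by (auto simp: component_def intro: rtranclp_trans reach_sym)

lemma conn_from: "c \<in> X \<Longrightarrow> (\<And>x. x \<in> X \<Longrightarrow> (edge_in adj X)\<^sup>*\<^sup>* c x) \<Longrightarrow> conn adj X"
  unfolding conn_def by (meson empty_iff reach_sym rtranclp_trans)

lemma conn_component: "conn adj (component adj S x)"
proof (rule conn_from[of x])
  fix y assume "y \<in> component adj S x"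
  then have "(edge_in adj S)\<^sup>*\<^sup>* x y" by (simp add: component_def)
  then have "y \<in> component adj S x \<and> (edge_in adj (component adj S x))\<^sup>*\<^sup>* x y"
  proof induction
    case (step y z)
    then have "z \<in> component adj S x" by (auto simp: component_def intro: rtranclp.rtrancl_into_rtrancl)
    with step show ?case by (auto simp: edge_in_def intro: rtranclp.rtrancl_into_rtrancl)
  qed simp
  then show "(edge_in adj (component adj S x))\<^sup>*\<^sup>* x y" by blast
qed simp

lemma conn_Union:
  assumes "\<And>X. X \<in> F \<Longrightarrow> conn adj X" "\<And>X. X \<in> F \<Longrightarrow> c \<in> X" "F \<noteq> {}"
  shows "conn adj (\<Union>F)"
proof (rule conn_from[of c])
  show "c \<in> \<Union>F" using assms by blast
  fix x assume "x \<in> \<Union>F"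
  then obtain X where "X \<in> F" "x \<in> X" by blast
  then have "(edge_in adj X)\<^sup>*\<^sup>* c x" using assms by (simp add: conn_def)
  then show "(edge_in adj (\<Union>F))\<^sup>*\<^sup>* c x" by (rule reach_mono) (use \<open>X \<in> F\<close> in blast)
qed

lemma conn_Un_edge:
  assumes "conn adj X" "conn adj Y" "x \<in> X" "y \<in> Y" "adj x y"
  shows "conn adj (X \<union> Y)"
proof (rule conn_from[of x])
  fix z assume "z \<in> X \<union> Y"
  have xy: "edge_in adj (X \<union> Y) x y" using assms by (simp add: edge_in_def)
  show "(edge_in adj (X \<union> Y))\<^sup>*\<^sup>* x z"
  proof (cases "z \<in> X")
    case True
    then have "(edge_in adj X)\<^sup>*\<^sup>* x z" using assms by (simp add: conn_def)
    then show ?thesis by (rule reach_mono) simp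
  next
    case False
    then have "(edge_in adj Y)\<^sup>*\<^sup>* y z" using assms \<open>z \<in> X \<union> Y\<close> by (simp add: conn_def)
    then have "(edge_in adj (X \<union> Y))\<^sup>*\<^sup>* y z" by (rule reach_mono) simp
    then show ?thesis by (rule converse_rtranclp_into_rtranclp[of "edge_in adj (X \<union> Y)", OF xy])
  qed
qed (use assms in simp)

lemma conn_gpath: "gpath S adj p \<Longrightarrow> conn adj (set p)"
proof (induction p rule: induct_list012)
  case (2 x) then show ?case by (simp add: conn_def)
next
  case (3 x y p)
  then have "conn adj ({x} \<union> set (y # p))"
    by (intro conn_Un_edge[of _ _ x y]) (auto simp: gpath_Cons conn_def[of _ "{_}"])
  then show ?case by (simp add: insert_commute)
qed (simp add: gpath_def)

text \<open>A union of paths in \<open>C\<close> from \<open>c\<close> to the vertices of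
  \<open>Z\<close> works, as paths are finite, connected and share \<open>c\<close>. A path from
  \<open>c\<close> to itself is added so that the union contains \<open>c\<close> even for empty
  \<open>Z\<close>.\<close>

lemma countable_conn_subset:
  assumes "conn adj C" "c \<in> C" "countable Z" "Z \<subseteq> C"
  obtains X where "countable X" "conn adj X" "c \<in> X" "Z \<subseteq> X" "X \<subseteq> C"
proof -
  have "\<exists>p. gpath C adj p \<and> hd p = c \<and> last p = z" if "z \<in> C" for z
    using assms(1,2) that reach_gpath[of adj C c z] unfolding conn_def by blast
  then have "\<forall>z\<in>C. \<exists>p. gpath C adj p \<and> hd p = c \<and> last p = z" by blast
  from bchoice[OF this] obtain p
    where p: "\<And>z. z \<in> C \<Longrightarrow> gpath C adj (p z) \<and> hd (p z) = c \<and> last (p z) = z" by blast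
  have p': "set (p z) \<subseteq> C" "c \<in> set (p z)" "z \<in> set (p z)" if "z \<in> C" for z
    using p[OF that] last_in_set[of "p z"] hd_in_set[of "p z"] by (auto simp: gpath_def)
  have cg: "conn adj (set (p z))" if "z \<in> C" for z using p[OF that] conn_gpath by blast
  define X where "X = (\<Union>z\<in>insert c Z. set (p z))"
  have "conn adj X" unfolding X_def
  proof (rule conn_Union)
    show "conn adj X" if "X \<in> (\<lambda>z. set (p z)) ` insert c Z" for X using that cg assms(2,4) by blast
    show "c \<in> X" if "X \<in> (\<lambda>z. set (p z)) ` insert c Z" for X using that p'(2) assms(2,4) by blast
  qed simp
  moreover have "countable X" unfolding X_def using assms by (auto intro: countable_finite)
  moreover have "c \<in> X" using p'(2)[OF assms(2)] by (simp add: X_def)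
  moreover have "Z \<subseteq> X"
  proof
    fix z assume "z \<in> Z"
    then show "z \<in> X" using p'(3)[of z] assms(4) unfolding X_def by blast
  qed
  moreover have "X \<subseteq> C" unfolding X_def using p'(1) assms(2,4) by (intro UN_least) auto
  ultimately show thesis by (intro that)
qed

end

section \<open>Rooted minors with countable branch sets\<close>

text \<open>Each value depends only on its index and the set of earlier values. This suffices below,
  where a new set has to avoid the earlier ones or is built outside their union.\<close>

lemma wf_recursion:
  fixes F :: "'a \<Rightarrow> 'b set \<Rightarrow> 'b"
  assumes "wf R"
  shows "\<exists>B. \<forall>j. B j = F j (B ` {i. (i, j) \<in> R})"
proof -
  define H where "H = (\<lambda>B j. F j (B ` {i. (i, j) \<in> R}))"
  have "wfrec R H j = F j (wfrec R H ` {i. (i, j) \<in> R})" for j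
  proof -
    have "cut (wfrec R H) R j ` {i. (i, j) \<in> R} = wfrec R H ` {i. (i, j) \<in> R}"
      by (intro image_cong) (auto simp: cut_apply)
    then show ?thesis by (subst wfrec[OF assms]) (simp add: H_def)
  qed
  then show ?thesis by (intro exI allI)
qed

definition nbrs_in :: "('a \<Rightarrow> 'a \<Rightarrow> bool) \<Rightarrow> 'a set \<Rightarrow> 'a set \<Rightarrow> 'a set" where
  "nbrs_in adj M D = {x \<in> M. \<exists>y\<in>D. adj x y}"

lemma nbrs_in_mono: "M \<subseteq> M' \<Longrightarrow> D \<subseteq> D' \<Longrightarrow> nbrs_in adj M D \<subseteq> nbrs_in adj M' D'"
  by (auto simp: nbrs_in_def)

locale colourable_minors =
  fixes V :: "'a set" and adj :: "'a \<Rightarrow> 'a \<Rightarrow> bool" and U :: "'a set"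
  assumes graph: "graph V adj"
    and col: "\<And>HV adjH. minor_of V adj HV adjH \<Longrightarrow> rooted_minor U HV \<Longrightarrow>
      countable_branch_sets HV \<Longrightarrow> countable_colouring_number HV adjH"
begin

lemma sym: "adj x y \<Longrightarrow> adj y x"
  and adj_V: "adj x y \<Longrightarrow> x \<in> V" "adj x y \<Longrightarrow> y \<in> V"
  using graph by (auto simp: graph_def)

lemma component_eq: "y \<in> component adj S x \<Longrightarrow> component adj S y = component adj S x"
  by (rule component_eq[of adj]) (rule sym)

lemma conn_component: "conn adj (component adj S x)"
  by (rule conn_component[of adj]) (rule sym)

definition branch_set :: "'a set \<Rightarrow> bool" where
  "branch_set X \<longleftrightarrow> X \<subseteq> V \<and> conn adj X \<and> X \<inter> U \<noteq> {} \<and> countable X"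

text \<open>The hypothesis \<open>col\<close> is applied to the minor on \<open>HV\<close> that has
  all edges \<open>G\<close> provides. Of its well-order only the finite sets \<open>f X\<close> of
  earlier neighbours are kept: of two adjacent branch sets, one comes first.\<close>

lemma back_neighbours:
  assumes HV: "\<And>X. X \<in> HV \<Longrightarrow> branch_set X"
    and disj: "\<And>X Y. X \<in> HV \<Longrightarrow> Y \<in> HV \<Longrightarrow> X \<noteq> Y \<Longrightarrow> X \<inter> Y = {}"
  shows "\<exists>f. (\<forall>X. finite (f X) \<and> f X \<subseteq> HV) \<and> (\<forall>X\<in>HV. \<forall>Y\<in>HV.
    X \<noteq> Y \<longrightarrow> (\<exists>x\<in>X. \<exists>y\<in>Y. adj x y) \<longrightarrow> X \<in> f Y \<or> Y \<in> f X)"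
proof -
  define adjH where "adjH X Y \<longleftrightarrow> X \<in> HV \<and> Y \<in> HV \<and> X \<noteq> Y \<and> (\<exists>x\<in>X. \<exists>y\<in>Y. adj x y)" for X Y
  have "minor_of V adj HV adjH"
    using HV disj sym by (fastforce simp: minor_of_def graph_def adjH_def connected_in_iff branch_set_def)
  moreover have "rooted_minor U HV" "countable_branch_sets HV"
    using HV by (auto simp: rooted_minor_def countable_branch_sets_def branch_set_def)
  ultimately obtain r where r: "well_order_on HV r"
    "\<forall>x\<in>HV. finite {y. adjH y x \<and> y \<noteq> x \<and> (y, x) \<in> r}"
    using col unfolding countable_colouring_number_def by blast
  define f where "f X = (if X \<in> HV then {Y. adjH Y X \<and> Y \<noteq> X \<and> (Y, X) \<in> r} else {})" for X
  show ?thesis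
  proof (intro exI[of _ f] conjI allI ballI impI)
    show "finite (f X)" for X using r by (simp add: f_def)
    show "f X \<subseteq> HV" for X by (auto simp: f_def adjH_def)
    fix X Y assume XY: "X \<in> HV" "Y \<in> HV" "X \<noteq> Y" "\<exists>x\<in>X. \<exists>y\<in>Y. adj x y"
    then have "adjH X Y" "adjH Y X" using sym by (auto simp: adjH_def)
    moreover have "(X, Y) \<in> r \<or> (Y, X) \<in> r"
      using r(1) XY by (auto simp: well_order_on_def linear_order_on_def total_on_def)
    ultimately show "X \<in> f Y \<or> Y \<in> f X" using XY by (auto simp: f_def)
  qed
qed

text \<open>
The minor consists of the sets of \<open>\<X>\<close> together with the vertices of \<open>A\<close>. A vertex \<open>x\<close> with
uncountably many attached sets becomes rooted by absorbing one of them, and the other vertices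
account for only countably many sets.
\<close>
lemma countable_infinitely_attached:
  assumes A: "countable A" "A \<subseteq> V"
    and \<X>: "\<And>X. X \<in> \<X> \<Longrightarrow> branch_set X"
    and disj: "\<And>X Y. X \<in> \<X> \<Longrightarrow> Y \<in> \<X> \<Longrightarrow> X \<noteq> Y \<Longrightarrow> X \<inter> Y = {}"
    and disjA: "\<And>X. X \<in> \<X> \<Longrightarrow> X \<inter> A = {}"
    and inf: "\<And>X. X \<in> \<X> \<Longrightarrow> infinite (nbrs_in adj A X)"
  shows "countable \<X>"
proof -
  define att where "att x = {X \<in> \<X>. \<exists>y\<in>X. adj x y}" for x
  define A' where "A' = {x \<in> A. uncountable (att x)}"
  define R where "R = {(y, x). y \<in> A \<and> x \<in> A \<and> to_nat_on A y < to_nat_on A x}"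
  have "wf R" by (rule wf_subset[of "inv_image less_than (to_nat_on A)"]) (auto simp: R_def)
  \<comment> \<open>Along an enumeration of \<open>A\<close>, each \<open>x \<in> A'\<close> picks
    an attached set different from all earlier picks. This is possible because \<open>att x\<close>
    is uncountable and only countably many sets have been picked; for other \<open>x\<close> the
    pick may be junk.\<close>
  define pick where "pick x S = (SOME X. X \<in> att x - S)" for x S
  from wf_recursion[OF \<open>wf R\<close>, of pick]
  obtain g where g: "\<forall>x. g x = pick x (g ` {y. (y, x) \<in> R})"
    by (elim exE)
  have g': "g x \<in> att x \<and> g x \<notin> g ` {y. (y, x) \<in> R}" if "x \<in> A'" for x
  proof -
    define S where "S = g ` {y. (y, x) \<in> R}"
    have "countable S" unfolding S_def
      by (rule countable_image, rule countable_subset[OF _ A(1)]) (auto simp: R_def)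
    moreover have "uncountable (att x)" using that by (simp add: A'_def)
    ultimately have "\<not> att x \<subseteq> S" using countable_subset by blast
    then have "\<exists>X. X \<in> att x - S" by blast
    then have "pick x S \<in> att x - S" unfolding pick_def by (rule someI_ex)
    moreover have "g x = pick x S" unfolding S_def by (rule g[THEN spec])
    ultimately show ?thesis unfolding S_def by simp
  qed
  have inj: "inj_on g A'"
  proof (rule inj_onI)
    fix x y assume xy: "x \<in> A'" "y \<in> A'" "g x = g y"
    have *: "(y, z) \<notin> R" if "z \<in> A'" "g y = g z" for y z
    proof
      assume "(y, z) \<in> R"
      then have "g y \<in> g ` {y. (y, z) \<in> R}" by (intro imageI) simp
      then show False unfolding that(2) using g'[OF that(1)] by (elim conjE notE)
    qed
    have "(x, y) \<notin> R" "(y, x) \<notin> R" using *[OF xy(2,3)] *[OF xy(1) xy(3)[symmetric]] by simp_all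
    then have "to_nat_on A x = to_nat_on A y" using xy(1,2) by (auto simp: R_def A'_def)
    then show "x = y" using xy(1,2) A by (auto simp: A'_def)
  qed
  define h where "h x = insert x (g x)" for x
  have hA: "h x \<inter> A = {x}" if "x \<in> A'" for x
    using that g'[OF that] disjA by (auto simp: h_def A'_def att_def)
  have injh: "inj_on h A'"
  proof (rule inj_onI)
    fix x y assume xy: "x \<in> A'" "y \<in> A'" and eq: "h x = h y"
    have "{x} = {y}" using hA[OF xy(1)] unfolding eq hA[OF xy(2)] by (rule HOL.sym)
    then show "x = y" by (rule singleton_inject)
  qed
  define HV where "HV = h ` A' \<union> (\<X> - g ` A')"
  have branch: "branch_set X" if "X \<in> HV" for X
    using that unfolding HV_def
  proof
    assume "X \<in> h ` A'"
    then obtain x where x: "x \<in> A'" "X = {x} \<union> g x" by (auto simp: h_def)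
    then obtain y where y: "g x \<in> \<X>" "y \<in> g x" "adj x y" using g'[OF x(1)] by (auto simp: att_def)
    have "conn adj X" unfolding x(2)
      by (rule conn_Un_edge[where x = x and y = y])
        (use y \<X>[of "g x"] sym in \<open>auto simp: branch_set_def conn_def[of _ "{_}"]\<close>)
    then show ?thesis using x y \<X>[of "g x"] A by (auto simp: branch_set_def A'_def)
  qed (use \<X> in blast)
  have disjH: "X \<inter> Y = {}" if XY: "X \<in> HV" "Y \<in> HV" "X \<noteq> Y" for X Y
  proof -
    have g\<X>: "g x \<in> \<X>" if "x \<in> A'" for x using g'[OF that] by (simp add: att_def)
    have gg: "g x \<inter> g y = {}" if "x \<in> A'" "y \<in> A'" "x \<noteq> y" for x y
      using that disj g\<X> inj by (meson inj_onD)
    have gX: "g x \<inter> Z = {}" if "x \<in> A'" "Z \<in> \<X> - g ` A'" for x Z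
      using that disj g\<X> by blast
    have gA: "z \<notin> Z" if "z \<in> A'" "Z \<in> \<X>" for z Z
      using that disjA[of Z] by (auto simp: A'_def)
    have hh: "h x \<inter> h y = {}" if "x \<in> A'" "y \<in> A'" "x \<noteq> y" for x y
      using gg[OF that] gA[of x "g y"] gA[of y "g x"] g\<X> that unfolding h_def by blast
    have hX: "h x \<inter> Z = {}" if "x \<in> A'" "Z \<in> \<X> - g ` A'" for x Z
      using gX[OF that] gA[of x Z] that unfolding h_def by blast
    from XY(1,2) consider x y where "x \<in> A'" "y \<in> A'" "X = h x" "Y = h y"
      | x where "x \<in> A'" "X = h x" "Y \<in> \<X> - g ` A'"
      | y where "y \<in> A'" "Y = h y" "X \<in> \<X> - g ` A'"
      | "X \<in> \<X>" "Y \<in> \<X>"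
      unfolding HV_def by blast
    then show ?thesis
    proof cases
      case 1 then show ?thesis using hh XY(3) by blast
    next
      case 2 then show ?thesis using hX by blast
    next
      case 3 then show ?thesis using hX[of y X] by blast
    next
      case 4 then show ?thesis using disj XY(3) by blast
    qed
  qed
  have "\<exists>f. (\<forall>X. finite (f X) \<and> f X \<subseteq> HV) \<and> (\<forall>X\<in>HV. \<forall>Y\<in>HV.
    X \<noteq> Y \<longrightarrow> (\<exists>x\<in>X. \<exists>y\<in>Y. adj x y) \<longrightarrow> X \<in> f Y \<or> Y \<in> f X)"
    by (rule back_neighbours) (fact branch, fact disjH)
  then obtain f where f0: "(\<forall>X. finite (f X) \<and> f X \<subseteq> HV) \<and> (\<forall>X\<in>HV. \<forall>Y\<in>HV.
    X \<noteq> Y \<longrightarrow> (\<exists>x\<in>X. \<exists>y\<in>Y. adj x y) \<longrightarrow> X \<in> f Y \<or> Y \<in> f X)" by (elim exE)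
  have f: "finite (f X)" for X
    using f0 by auto
  have fadj: "X \<in> f Y \<or> Y \<in> f X"
    if "X \<in> HV" "Y \<in> HV" "X \<noteq> Y" "\<exists>x\<in>X. \<exists>y\<in>Y. adj x y" for X Y
    using f0 that by blast
  define \<X>0 where "\<X>0 = (\<Union>x\<in>A - A'. att x)"
  have "\<X> \<subseteq> g ` A' \<union> \<X>0 \<union> (\<Union>x\<in>A'. f (h x))"
  proof
    fix X assume X: "X \<in> \<X>"
    show "X \<in> g ` A' \<union> \<X>0 \<union> (\<Union>x\<in>A'. f (h x))"
    proof (rule ccontr)
      \<comment> \<open>Such an \<open>X\<close> has all its attachments in \<open>A'\<close>, and
        it is not an earlier neighbour of any \<open>h x\<close>. Hence \<open>h x \<in> f X\<close>
        for every attachment \<open>x\<close>, and these are infinitely many distinct members of a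
        finite set.\<close>
      assume neg: "\<not> ?thesis"
      have "nbrs_in adj A X \<subseteq> A'"
        using neg X by (auto simp: nbrs_in_def \<X>0_def att_def)
      moreover have "h x \<in> f X" if "x \<in> nbrs_in adj A X" "x \<in> A'" for x
      proof -
        have "h x \<in> HV" "X \<in> HV" "h x \<noteq> X" using that neg X hA[of x] disjA[of X] by (auto simp: HV_def)
        moreover have "\<exists>z\<in>h x. \<exists>y\<in>X. adj z y" using that by (auto simp: h_def nbrs_in_def)
        ultimately have "h x \<in> f X \<or> X \<in> f (h x)" by (rule fadj)
        then show ?thesis using neg that by blast
      qed
      ultimately have "h ` nbrs_in adj A X \<subseteq> f X" "inj_on h (nbrs_in adj A X)"
        using injh by (auto intro: inj_on_subset)
      then show False using f[of X] inf[OF X] by (meson finite_imageD finite_subset)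
    qed
  qed
  moreover have "countable (g ` A' \<union> \<X>0 \<union> (\<Union>x\<in>A'. f (h x)))"
  proof -
    have "countable A'" "countable (A - A')" using A by (auto simp: A'_def intro: countable_subset)
    moreover have "countable (att x)" if "x \<in> A - A'" for x using that by (auto simp: A'_def)
    moreover have "countable (f X)" for X using f by (rule countable_finite)
    ultimately show ?thesis unfolding \<X>0_def
      by (intro countable_Un countable_image countable_UN) auto
  qed
  ultimately show ?thesis by (rule countable_subset)
qed

text \<open>The set \<open>X\<close> connects \<open>c\<close>, a vertex of \<open>U\<close> and one
  neighbour in \<open>C\<close> for each member of a countably infinite set of attachments, if there
  is one.\<close>

lemma attached_branch_set:
  assumes C: "conn adj C" "c \<in> C" "C \<inter> U \<noteq> {}"
  shows "\<exists>X. countable X \<and> conn adj X \<and> c \<in> X \<and> X \<subseteq> C \<and> X \<inter> U \<noteq> {} \<and>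
    (infinite (nbrs_in adj N C) \<longrightarrow> infinite (nbrs_in adj N X))"
proof -
  obtain u where u: "u \<in> C" "u \<in> U" using C by blast
  have "\<exists>S. countable S \<and> S \<subseteq> nbrs_in adj N C \<and> (infinite (nbrs_in adj N C) \<longrightarrow> infinite S)"
  proof (cases "finite (nbrs_in adj N C)")
    case True
    then show ?thesis by (intro exI[of _ "{}"]) simp
  next
    case False
    from infinite_countable_subset'[OF False] show ?thesis by blast
  qed
  then obtain S where S: "countable S" "S \<subseteq> nbrs_in adj N C" "infinite (nbrs_in adj N C) \<Longrightarrow> infinite S"
    by blast
  have "\<forall>x\<in>S. \<exists>z. z \<in> C \<and> adj x z" using S by (auto simp: nbrs_in_def)
  from bchoice[OF this] obtain z where z: "\<forall>x\<in>S. z x \<in> C \<and> adj x (z x)" by blast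
  have "countable (insert u (z ` S))" "insert u (z ` S) \<subseteq> C" using S u z by auto
  from countable_conn_subset[OF sym C(1,2) this]
  obtain X where X: "countable X" "conn adj X" "c \<in> X" "insert u (z ` S) \<subseteq> X" "X \<subseteq> C" .
  have "S \<subseteq> nbrs_in adj N X"
  proof
    fix x assume "x \<in> S"
    then have "x \<in> N" "z x \<in> X" "adj x (z x)" using S X z by (auto simp: nbrs_in_def)
    then show "x \<in> nbrs_in adj N X" by (auto simp: nbrs_in_def)
  qed
  then have "infinite (nbrs_in adj N C) \<longrightarrow> infinite (nbrs_in adj N X)"
    using S(3) finite_subset by blast
  moreover have "X \<inter> U \<noteq> {}" using X u by blast
  ultimately show ?thesis using X by blast
qed

text \<open>
Suppose that \<open>M\<close> is closed under \<open>R\<close> and contains all predecessors of \<open>\<xi>\<close>, and let \<open>C \<xi>\<close> be the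
component of \<open>\<delta> \<xi>\<close> outside \<open>N \<xi> = (\<Union>j<\<xi>. B j)\<close>. If \<open>C \<xi>\<close> has finite neighbourhood \<open>G\<close>, then it
misses \<open>M\<close>: from a vertex of \<open>M \<inter> C \<xi>\<close> and \<open>G\<close>, the function \<open>h\<close> would compute the least \<open>j\<close> with
\<open>\<delta> j \<in> C \<xi>\<close>, but \<open>\<delta> j \<in> N \<xi>\<close> as \<open>j < \<xi>\<close>. Otherwise \<open>B \<xi>\<close> has infinitely many neighbours in \<open>N \<xi>\<close>.
The countable sets \<open>J i\<close> exclude that infinitely many of them lie in one \<open>B i\<close>, and the colouring order
\<open>f\<close> of the minor excludes that they are spread over infinitely many \<open>B i\<close>.
\<close>
lemma finite_attachment_step:
  fixes lt :: "'a rel" and \<delta> :: "'a \<Rightarrow> 'a"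
  assumes wf: "wf lt" and total: "\<And>x y. x \<noteq> y \<Longrightarrow> (x, y) \<in> lt \<or> (y, x) \<in> lt"
    and tr: "trans lt"
  obtains R :: "'a list \<Rightarrow> 'a set" where "\<And>xs. countable (R xs)"
    "\<And>M \<xi> u. (\<And>xs. xs \<in> lists M \<Longrightarrow> R xs \<subseteq> M) \<Longrightarrow> \<xi> \<notin> M \<Longrightarrow> (\<And>j. (j, \<xi>) \<in> lt \<Longrightarrow> j \<in> M) \<Longrightarrow>
      u \<in> U \<Longrightarrow> u \<in> V - M \<Longrightarrow> \<delta> \<xi> \<in> component adj (V - M) u \<Longrightarrow>
      finite (nbrs_in adj M (component adj (V - M) u))"
proof -
  define good where "good N c X \<longleftrightarrow> countable X \<and> conn adj X \<and> c \<in> X \<and> X \<subseteq> component adj (V - N) c \<and>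
    X \<inter> U \<noteq> {} \<and> (infinite (nbrs_in adj N (component adj (V - N) c)) \<longrightarrow> infinite (nbrs_in adj N X))"
    for N c X
  \<comment> \<open>If the component of \<open>\<delta> j\<close> misses \<open>U\<close>, no rooted
    branch set is available and \<open>B j\<close> is just the vertex \<open>\<delta> j\<close>.
    Thus in every case \<open>\<delta> j\<close>, if it is in \<open>V\<close>, lies in
    \<open>B j\<close> or in an earlier set.\<close>
  define F where "F j S = (if \<delta> j \<notin> V - \<Union>S then {}
      else if component adj (V - \<Union>S) (\<delta> j) \<inter> U = {} then {\<delta> j} else SOME X. good (\<Union>S) (\<delta> j) X)" for j S
  from wf_recursion[OF wf, of F]
  obtain B where B: "\<forall>j. B j = F j (B ` {i. (i, j) \<in> lt})" by (elim exE)
  define N where "N j = \<Union>(B ` {i. (i, j) \<in> lt})" for j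
  define C where "C j = component adj (V - N j) (\<delta> j)" for j
  define I where "I = {j. \<delta> j \<in> V - N j \<and> C j \<inter> U \<noteq> {}}"
  have Bempty: "B j = {}" if "\<delta> j \<notin> V - N j" for j
    using that B[rule_format, of j] by (simp add: F_def N_def)
  have Bsingle: "B j = {\<delta> j}" if "\<delta> j \<in> V - N j" "C j \<inter> U = {}" for j
    using that B[rule_format, of j] by (simp add: F_def N_def C_def)
  have BI: "good (N j) (\<delta> j) (B j)" if "j \<in> I" for j
  proof -
    have "\<exists>X. good (N j) (\<delta> j) X"
      unfolding good_def
    proof (intro attached_branch_set conn_component component_refl)
      show "component adj (V - N j) (\<delta> j) \<inter> U \<noteq> {}" using that unfolding I_def C_def by blast
    qed
    moreover have "B j = (SOME X. good (N j) (\<delta> j) X)"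
      using that B[rule_format, of j] by (simp add: F_def N_def C_def I_def)
    ultimately show ?thesis by (simp add: someI_ex)
  qed
  have CV: "C j \<subseteq> V - N j" if "\<delta> j \<in> V - N j" for j
    unfolding C_def using that by (rule component_subset)
  have Bin: "\<delta> j \<in> B j \<and> B j \<subseteq> C j \<and> conn adj (B j) \<and> countable (B j)" if "\<delta> j \<in> V - N j" for j
  proof (cases "C j \<inter> U = {}")
    case True
    then show ?thesis using Bsingle[OF that] by (auto simp: C_def conn_def)
  next
    case False
    then show ?thesis using BI[of j] that by (auto simp: I_def good_def C_def)
  qed
  have BV: "B j \<subseteq> V - N j" for j using Bempty[of j] Bin[of j] CV[of j] by blast
  have Bcount: "countable (B j)" for j using Bempty[of j] Bin[of j] by fastforce
  have BN: "B i \<subseteq> N j" if "(i, j) \<in> lt" for i j using that by (auto simp: N_def)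
  have NN: "N i \<subseteq> N j" if "(i, j) \<in> lt" for i j using that tr by (auto simp: N_def dest: transD)
  have disj: "B i \<inter> B j = {}" if "i \<noteq> j" for i j
    using total[OF that] BN[of i j] BN[of j i] BV[of i] BV[of j] by blast
  have disj': "X \<inter> Y = {}" if "X \<in> B ` I1" "Y \<in> B ` I2" "X \<noteq> Y" for X Y I1 I2
  proof -
    from that obtain i j where "X = B i" "Y = B j" by (elim imageE)
    with that(3) show ?thesis using disj[of i j] by (cases "i = j") simp_all
  qed
  have branch: "branch_set (B j)" if "j \<in> I" for j
    using BI[OF that] BV[of j] by (auto simp: branch_set_def good_def)
  have \<delta>B: "\<delta> j \<in> B j" if "j \<in> I" for j using BI[OF that] by (simp add: good_def)
  have injB: "inj_on B I"
  proof (rule inj_onI, rule ccontr)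
    fix i j assume ij: "i \<in> I" "j \<in> I" "B i = B j" "i \<noteq> j"
    have "\<delta> j \<in> B i \<inter> B j" using \<delta>B[OF ij(2)] unfolding ij(3) by blast
    then show False using disj[OF ij(4)] by blast
  qed
  have "\<exists>f. (\<forall>X. finite (f X) \<and> f X \<subseteq> B ` I) \<and> (\<forall>X\<in>B ` I. \<forall>Y\<in>B ` I.
    X \<noteq> Y \<longrightarrow> (\<exists>x\<in>X. \<exists>y\<in>Y. adj x y) \<longrightarrow> X \<in> f Y \<or> Y \<in> f X)"
  proof (rule back_neighbours)
    show "branch_set X" if "X \<in> B ` I" for X using that branch by blast
    show "X \<inter> Y = {}" if "X \<in> B ` I" "Y \<in> B ` I" "X \<noteq> Y" for X Y using that by (rule disj')
  qed
  then obtain f where f0: "(\<forall>X. finite (f X) \<and> f X \<subseteq> B ` I) \<and> (\<forall>X\<in>B ` I. \<forall>Y\<in>B ` I.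
    X \<noteq> Y \<longrightarrow> (\<exists>x\<in>X. \<exists>y\<in>Y. adj x y) \<longrightarrow> X \<in> f Y \<or> Y \<in> f X)" by (elim exE)
  have f: "finite (f X)" "f X \<subseteq> B ` I" for X
    using f0[THEN conjunct1, THEN spec, of X] by blast+
  have fadj: "X \<in> f Y \<or> Y \<in> f X"
    if "X \<in> B ` I" "Y \<in> B ` I" "X \<noteq> Y" "\<exists>x\<in>X. \<exists>y\<in>Y. adj x y" for X Y
    using f0[THEN conjunct2, THEN bspec, THEN bspec, OF that(1,2)] that(3,4) by blast
  define J where "J i = {j \<in> I. j \<noteq> i \<and> infinite (nbrs_in adj (B i) (B j))}" for i
  have J: "countable (J i)" for i
  proof (rule countable_image_inj_on)
    show "inj_on B (J i)" using injB by (rule inj_on_subset) (auto simp: J_def)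
    show "countable (B ` J i)"
    proof (rule countable_infinitely_attached[OF Bcount[of i]])
      show "B i \<subseteq> V" using BV by blast
      show "branch_set X" if "X \<in> B ` J i" for X using that branch by (auto simp: J_def)
      show "X \<inter> Y = {}" if "X \<in> B ` J i" "Y \<in> B ` J i" "X \<noteq> Y" for X Y using that by (rule disj')
      show "X \<inter> B i = {}" if "X \<in> B ` J i" for X using that disj by (auto simp: J_def)
      show "infinite (nbrs_in adj (B i) X)" if "X \<in> B ` J i" for X using that by (auto simp: J_def)
    qed
  qed
  define h where "h x G = (SOME j. \<delta> j \<in> component adj (V - G) x \<and>
    (\<forall>i. (i, j) \<in> lt \<longrightarrow> \<delta> i \<notin> component adj (V - G) x))" for x G
  \<comment> \<open>Indices and vertices have the same type, and \<open>x\<close> is used as both: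
    \<open>B x\<close> and \<open>J x\<close> read it as an index, \<open>h\<close> and the
    condition \<open>x \<in> B i\<close> as a vertex. The last union consists of the earlier
    neighbours of the branch set containing \<open>x\<close>.\<close>
  define R where "R xs = (case xs of [] \<Rightarrow> {} | x # G \<Rightarrow>
    insert (h x (set G)) (B x \<union> \<Union>(B ` J x) \<union> (\<Union>i\<in>{i \<in> I. x \<in> B i}. \<Union>(f (B i)))))" for xs
  show thesis
  proof (rule that[of R])
    fix xs
    have "countable (\<Union>i\<in>{i \<in> I. x \<in> B i}. \<Union>(f (B i)))" for x
    proof (rule countable_UN)
      have "i = j" if "x \<in> B i" "x \<in> B j" for i j using that disj by blast
      then have "{i \<in> I. x \<in> B i} = {} \<or> (\<exists>j. {i \<in> I. x \<in> B i} = {j})" by blast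
      then show "countable {i \<in> I. x \<in> B i}" by (elim disjE exE; elim ssubst; simp)
      fix i
      have "countable Z" if "Z \<in> f (B i)" for Z using that f(2)[of "B i"] Bcount by (auto dest!: subsetD)
      then show "countable (\<Union>(f (B i)))"
        using countable_UN[of "f (B i)" "\<lambda>Z. Z"] countable_finite[OF f(1), of "B i"] by simp
    qed
    then show "countable (R xs)" using Bcount J by (auto simp: R_def split: list.split)
  next
    fix M \<xi> u
    assume closed: "\<And>xs. xs \<in> lists M \<Longrightarrow> R xs \<subseteq> M" and \<xi>: "\<xi> \<notin> M" "\<And>j. (j, \<xi>) \<in> lt \<Longrightarrow> j \<in> M"
      and u: "u \<in> U" "u \<in> V - M" and \<delta>\<xi>: "\<delta> \<xi> \<in> component adj (V - M) u"
    let ?D = "component adj (V - M) u"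
    have R1: "h x G \<in> M" if "x \<in> M" "G \<subseteq> M" "finite G" for x G
    proof -
      obtain ys where "set ys = G" using \<open>finite G\<close> finite_list by blast
      then show ?thesis using closed[of "x # ys"] that by (auto simp: R_def)
    qed
    have R': "B x \<union> \<Union>(B ` J x) \<union> (\<Union>i\<in>{i \<in> I. x \<in> B i}. \<Union>(f (B i))) \<subseteq> M" if "x \<in> M" for x
      using closed[of "[x]"] that by (simp add: R_def)
    have R2: "B x \<subseteq> M" "\<And>j. j \<in> J x \<Longrightarrow> B j \<subseteq> M" if "x \<in> M" for x
      using R'[OF that] by blast+
    have R3: "Z \<subseteq> M" if "x \<in> M" "i \<in> I" "x \<in> B i" "Z \<in> f (B i)" for x i Z
    proof -
      have "Z \<subseteq> (\<Union>i\<in>{i \<in> I. x \<in> B i}. \<Union>(f (B i)))" using that by blast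
      then show ?thesis using R'[OF that(1)] by blast
    qed
    have DV: "?D \<subseteq> V - M" using u(2) by (rule component_subset)
    have NM: "N \<xi> \<subseteq> M" using R2(1) \<xi>(2) by (auto simp: N_def)
    have \<delta>V: "\<delta> \<xi> \<in> V - N \<xi>" using \<delta>\<xi> DV NM by blast
    have DVN: "?D \<subseteq> V - N \<xi>"
      using DV Diff_mono[OF subset_refl NM, of V] by (rule subset_trans)
    have DC: "?D \<subseteq> C \<xi>" unfolding C_def
      using conn_component DVN \<delta>\<xi> by (rule conn_subset_component)
    have uC: "u \<in> C \<xi>" using component_refl DC by (rule subsetD[rotated])
    then have \<xi>I: "\<xi> \<in> I" using \<delta>V u by (auto simp: I_def)
    have notM: "\<not> B \<xi> \<subseteq> M" using \<delta>B[OF \<xi>I] \<delta>\<xi> DV by blast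
    show "finite (nbrs_in adj M ?D)"
    proof (cases "finite (nbrs_in adj (N \<xi>) (C \<xi>))")
      case fin: True
      define G where "G = nbrs_in adj (N \<xi>) (C \<xi>)"
      have CG: "C \<xi> \<inter> G = {}" using CV[OF \<delta>V] by (auto simp: G_def nbrs_in_def)
      have "C \<xi> \<inter> M = {}"
      proof (rule ccontr)
        assume "C \<xi> \<inter> M \<noteq> {}"
        then obtain x where x: "x \<in> C \<xi>" "x \<in> M" by blast
        \<comment> \<open>All neighbours of \<open>C \<xi>\<close> in \<open>N \<xi>\<close> lie in
          \<open>G\<close>, so deleting the finite set \<open>G\<close> already isolates
          \<open>C \<xi>\<close>. It is therefore determined by \<open>x\<close> and
          \<open>G\<close>, which are finite data from \<open>M\<close>.\<close>
        have "component adj (V - G) x = C \<xi>"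
        proof
          show "C \<xi> \<subseteq> component adj (V - G) x"
            by (rule conn_subset_component[OF _ _ x(1)])
              (use conn_component[of "V - N \<xi>" "\<delta> \<xi>"] CG CV[OF \<delta>V] in \<open>unfold C_def, blast+\<close>)
          show "component adj (V - G) x \<subseteq> C \<xi>"
          proof (rule component_least[OF x(1)])
            fix y z assume yz: "y \<in> C \<xi>" "adj y z" "z \<in> V - G"
            have "z \<notin> N \<xi>" using yz(1,3) sym[OF yz(2)] by (auto simp: G_def nbrs_in_def)
            then show "z \<in> C \<xi>" using component_step[of y adj "V - N \<xi>" "\<delta> \<xi>" z] yz \<delta>V
              by (simp add: C_def)
          qed
        qed
        note eq = this
        define P where "P j \<longleftrightarrow> \<delta> j \<in> C \<xi> \<and> (\<forall>i. (i, j) \<in> lt \<longrightarrow> \<delta> i \<notin> C \<xi>)" for j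
        have "\<delta> \<xi> \<in> C \<xi>" using DC \<delta>\<xi> by (rule subsetD)
        then have "\<xi> \<in> {j. \<delta> j \<in> C \<xi>}" by simp
        from wf[unfolded wf_eq_minimal, THEN spec, THEN spec, THEN mp, OF this]
        have "\<exists>i. P i" by (simp add: P_def Bex_def)
        define j where "j = h x G"
        have "j = (SOME j. P j)" by (simp only: j_def h_def eq P_def)
        with someI_ex[OF \<open>\<exists>i. P i\<close>] have "P j" by (simp only:)
        then have j: "\<delta> j \<in> C \<xi>" "\<And>i. (i, j) \<in> lt \<Longrightarrow> \<delta> i \<notin> C \<xi>"
          by (simp_all add: P_def)
        have "G \<subseteq> M" using NM by (auto simp: G_def nbrs_in_def)
        then have "j \<in> M" unfolding j_def using x fin by (intro R1) (auto simp: G_def)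
        then have "j \<noteq> \<xi>" using \<xi> by blast
        moreover have "(\<xi>, j) \<notin> lt" using j(2) DC \<delta>\<xi> by blast
        ultimately have lt: "(j, \<xi>) \<in> lt" using total by blast
        \<comment> \<open>Either \<open>\<delta> j\<close> was put into \<open>B j\<close>, or it
          lay in \<open>N j\<close> before; both are part of \<open>N \<xi>\<close>.\<close>
        have "\<delta> j \<in> N \<xi>"
        proof (cases "\<delta> j \<in> V - N j")
          case True
          then show ?thesis using Bin[OF True] BN[OF lt] by blast
        next
          case False
          then show ?thesis using j(1) CV[OF \<delta>V] NN[OF lt] by blast
        qed
        then show False using j(1) CV[OF \<delta>V] by blast
      qed
      then have "C \<xi> \<subseteq> V - M" using CV[OF \<delta>V] by blast
      moreover have "conn adj (C \<xi>)" unfolding C_def by (rule conn_component)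
      ultimately have "C \<xi> \<subseteq> ?D" using uC by (intro conn_subset_component)
      then have CD: "C \<xi> = ?D" using DC by blast
      have "nbrs_in adj M ?D \<subseteq> G"
      proof
        fix x assume "x \<in> nbrs_in adj M ?D"
        then obtain y where y: "x \<in> M" "y \<in> C \<xi>" "adj x y" using CD by (auto simp: nbrs_in_def)
        have "x \<in> N \<xi>"
        proof (rule ccontr)
          assume "x \<notin> N \<xi>"
          then have "x \<in> C \<xi>"
            using component_step[of y adj "V - N \<xi>" "\<delta> \<xi>" x] y(2) sym[OF y(3)] adj_V(1)[OF y(3)] \<delta>V
            by (simp add: C_def)
          then show False using \<open>C \<xi> \<subseteq> V - M\<close> y by blast
        qed
        then show "x \<in> G" using y by (auto simp: G_def nbrs_in_def)
      qed
      then show ?thesis using fin unfolding G_def by (rule finite_subset)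
    next
      case False
      then have inf: "infinite (nbrs_in adj (N \<xi>) (B \<xi>))"
        using BI[OF \<xi>I] by (simp add: good_def C_def)
      define K where "K = {i. (i, \<xi>) \<in> lt \<and> nbrs_in adj (B i) (B \<xi>) \<noteq> {}}"
      have KM: "i \<in> M" "i \<noteq> \<xi>" if "i \<in> K" for i using that \<xi> by (auto simp: K_def)
      \<comment> \<open>Otherwise \<open>\<xi> \<in> J i\<close>, and closure would put all of
        \<open>B \<xi>\<close> into \<open>M\<close>, although \<open>\<delta> \<xi>\<close> is
        outside \<open>M\<close>.\<close>
      have fin: "finite (nbrs_in adj (B i) (B \<xi>))" if "i \<in> K" for i
        using KM[OF that] R2(2)[of i \<xi>] \<xi>I notM by (auto simp: J_def)
      have "nbrs_in adj (N \<xi>) (B \<xi>) \<subseteq> (\<Union>i\<in>K. nbrs_in adj (B i) (B \<xi>))"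
        by (auto simp: N_def K_def nbrs_in_def)
      then have "infinite K" using inf fin by (meson finite_UN_I finite_subset)
      \<comment> \<open>The connected set \<open>C \<xi>\<close> avoids \<open>N i\<close> and has a
        neighbour in \<open>B i\<close>, so it lies inside \<open>C i\<close>. Hence
        \<open>C i\<close> contains \<open>u\<close>, and \<open>B i\<close> is a genuine branch
        set.\<close>
      have KI: "i \<in> I" if iK: "i \<in> K" for i
      proof -
        obtain b y where b: "b \<in> B i" "y \<in> B \<xi>" "adj b y" "(i, \<xi>) \<in> lt"
          using iK by (auto simp: K_def nbrs_in_def)
        have \<delta>i: "\<delta> i \<in> V - N i" using Bempty[of i] b by blast
        then have "b \<in> C i" using Bin b by blast
        have y: "y \<in> C \<xi>" using Bin[OF \<delta>V] b by blast
        have sub: "C \<xi> \<subseteq> V - N i" using CV[OF \<delta>V] NN b by blast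
        have "y \<in> C i" unfolding C_def
        proof (rule component_step)
          show "b \<in> component adj (V - N i) (\<delta> i)" using \<open>b \<in> C i\<close> by (simp only: C_def)
          show "adj b y" "\<delta> i \<in> V - N i" by fact+
          show "y \<in> V - N i" using y sub by (rule subsetD[rotated])
        qed
        then have "component adj (V - N i) y = C i" unfolding C_def by (rule component_eq)
        moreover have "conn adj (C \<xi>)" unfolding C_def by (rule conn_component)
        then have "C \<xi> \<subseteq> component adj (V - N i) y" using sub y by (rule conn_subset_component)
        ultimately show ?thesis using uC u(1) \<delta>i by (auto simp: I_def)
      qed
      \<comment> \<open>The vertex \<open>\<delta> i\<close> of \<open>B i\<close> lies in
        \<open>M\<close>, so closure puts all earlier neighbours of \<open>B i\<close> into
        \<open>M\<close>. As \<open>B \<xi>\<close> is not contained in \<open>M\<close>, the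
        colouring must place \<open>B i\<close> before \<open>B \<xi>\<close>.\<close>
      have "B i \<in> f (B \<xi>)" if "i \<in> K" for i
      proof -
        have ne: "B i \<noteq> B \<xi>" using KM(2)[OF that] injB KI[OF that] \<xi>I by (meson inj_onD)
        have "B i \<in> f (B \<xi>) \<or> B \<xi> \<in> f (B i)"
          by (rule fadj) (use ne KI[OF that] \<xi>I that in \<open>auto simp: K_def nbrs_in_def\<close>)
        moreover have "\<delta> i \<in> M" using R2(1) KM(1)[OF that] \<delta>B[OF KI[OF that]] by blast
        then have "B \<xi> \<notin> f (B i)" using R3[OF _ KI[OF that] \<delta>B[OF KI[OF that]]] notM by blast
        ultimately show ?thesis by blast
      qed
      then have "finite (B ` K)" using f(1)[of "B \<xi>"] by (meson finite_subset image_subsetI)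
      moreover have "inj_on B K" using injB by (rule inj_on_subset) (use KI in blast)
      ultimately show ?thesis using \<open>infinite K\<close> finite_imageD by blast
    qed
  qed
qed

end

section \<open>A closure operator with finite adhesion\<close>

definition closed_under :: "('a list \<Rightarrow> 'a set) \<Rightarrow> 'a set \<Rightarrow> bool" where
  "closed_under K M \<longleftrightarrow> (\<forall>xs\<in>lists M. K xs \<subseteq> M)"

text \<open>A list has finitely many entries, so it already lies over one member of the chain.
  Nonemptiness of the chain takes care of the empty list.\<close>

lemma closed_under_Union_chain:
  assumes "\<And>M. M \<in> \<C> \<Longrightarrow> closed_under K M" "\<And>M N. M \<in> \<C> \<Longrightarrow> N \<in> \<C> \<Longrightarrow> M \<subseteq> N \<or> N \<subseteq> M" "\<C> \<noteq> {}"
  shows "closed_under K (\<Union>\<C>)"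
proof -
  have *: "\<exists>M\<in>\<C>. xs \<in> lists M" if "xs \<in> lists (\<Union>\<C>)" for xs
    using that
  proof (induction xs)
    case Nil
    then show ?case using assms(3) by auto
  next
    case (Cons x xs)
    then have "x \<in> \<Union>\<C>" "\<exists>M\<in>\<C>. xs \<in> lists M" by simp_all
    then obtain M N where MN: "M \<in> \<C>" "N \<in> \<C>" "xs \<in> lists M" "x \<in> N" by blast
    from assms(2)[OF MN(1,2)] show ?case
    proof
      assume "M \<subseteq> N"
      then have "x # xs \<in> lists N" using MN(3,4) by (simp add: in_lists_conv_set subset_iff)
      then show ?thesis using MN(2) by (rule bexI)
    next
      assume "N \<subseteq> M"
      then have "x # xs \<in> lists M" using MN(3,4) by (simp add: in_lists_conv_set subset_iff)
      then show ?thesis using MN(1) by (rule bexI)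
    qed
  qed
  show ?thesis unfolding closed_under_def
  proof
    fix xs assume "xs \<in> lists (\<Union>\<C>)"
    then obtain M where M: "M \<in> \<C>" "xs \<in> lists M" using * by blast
    then have "K xs \<subseteq> M" using assms(1) by (simp add: closed_under_def)
    then show "K xs \<subseteq> \<Union>\<C>" using M(1) by blast
  qed
qed

context colourable_minors
begin

text \<open>The closure is built in countable-valued stages. Enumerating a stage turns the
  dependence of a generated vertex on one parameter into a function \<open>\<delta>\<close>, and the
  next stage includes the guards \<open>R \<delta>\<close> of \<open>finite_attachment_step\<close>
  against all functions so obtained. For closed \<open>M\<close> and a component \<open>D\<close>,
  that lemma is applied to a maximal closed set that contains \<open>M\<close> and misses
  \<open>D\<close>.\<close>

lemma finite_adhesion_closure:
  shows "\<exists>K :: 'a list \<Rightarrow> 'a set. (\<forall>xs. countable (K xs)) \<and> (\<forall>xs. set xs \<subseteq> K xs) \<and>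
    (\<forall>xs ys. set xs \<subseteq> set ys \<longrightarrow> K xs \<subseteq> K ys) \<and> (\<forall>S. closed_under K (\<Union>(K ` lists S))) \<and>
    (\<forall>M u. closed_under K M \<longrightarrow> u \<in> U \<longrightarrow> u \<in> V - M \<longrightarrow>
      finite (nbrs_in adj M (component adj (V - M) u)))"
proof -
  obtain r :: "'a rel" where r: "well_order_on UNIV r" using well_order_on[of UNIV] by (elim exE)
  define lt where "lt = r - Id"
  have wf: "wf lt" using r by (simp add: well_order_on_def lt_def)
  have total: "(x, y) \<in> lt \<or> (y, x) \<in> lt" if "x \<noteq> y" for x y
    using r that by (auto simp: well_order_on_def linear_order_on_def total_on_def lt_def)
  have "trans r" "antisym r"
    using r by (simp_all add: well_order_on_def linear_order_on_def partial_order_on_def preorder_on_def)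
  then have tr: "trans lt" unfolding lt_def by (rule trans_diff_Id)
  define step_ok where "step_ok \<delta> R \<longleftrightarrow> (\<forall>xs. countable (R xs)) \<and>
    (\<forall>M \<xi> u. closed_under R M \<longrightarrow> \<xi> \<notin> M \<longrightarrow> (\<forall>j. (j, \<xi>) \<in> lt \<longrightarrow> j \<in> M) \<longrightarrow>
      u \<in> U \<longrightarrow> u \<in> V - M \<longrightarrow> \<delta> \<xi> \<in> component adj (V - M) u \<longrightarrow>
      finite (nbrs_in adj M (component adj (V - M) u)))" for \<delta> :: "'a \<Rightarrow> 'a" and R
  have "\<forall>\<delta>. \<exists>R. step_ok \<delta> R"
  proof
    fix \<delta>
    show "\<exists>R. step_ok \<delta> R"
    proof (rule finite_attachment_step[OF wf total tr, of \<delta>])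
      fix R :: "'a list \<Rightarrow> 'a set"
      assume c: "\<And>xs. countable (R xs)" and
        fin: "\<And>M \<xi> u. (\<And>xs. xs \<in> lists M \<Longrightarrow> R xs \<subseteq> M) \<Longrightarrow> \<xi> \<notin> M \<Longrightarrow>
          (\<And>j. (j, \<xi>) \<in> lt \<Longrightarrow> j \<in> M) \<Longrightarrow>
          u \<in> U \<Longrightarrow> u \<in> V - M \<Longrightarrow> \<delta> \<xi> \<in> component adj (V - M) u \<Longrightarrow>
          finite (nbrs_in adj M (component adj (V - M) u))"
      have "step_ok \<delta> R" unfolding step_ok_def closed_under_def
      proof (intro conjI allI impI)
        show "countable (R xs)" for xs by (rule c)
      next
        fix M \<xi> u
        assume a: "\<forall>xs\<in>lists M. R xs \<subseteq> M" "\<xi> \<notin> M" "\<forall>j. (j, \<xi>) \<in> lt \<longrightarrow> j \<in> M"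
          "u \<in> U" "u \<in> V - M" "\<delta> \<xi> \<in> component adj (V - M) u"
        show "finite (nbrs_in adj M (component adj (V - M) u))"
          by (rule fin[OF bspec[OF a(1)] a(2) a(3)[THEN spec, THEN mp] a(4,5,6)])
      qed
      then show "\<exists>R. step_ok \<delta> R" by (rule exI[of _ R])
    qed
  qed
  from choice[OF this] obtain R where R: "\<forall>\<delta>. step_ok \<delta> (R \<delta>)" by (elim exE)
  have Rcount: "countable (R \<delta> xs)" for \<delta> xs
    using R[THEN spec, of \<delta>, unfolded step_ok_def, THEN conjunct1] by (rule spec)
  \<comment> \<open>The first \<open>n\<close> entries of \<open>ys\<close> are fixed parameters of
    the function of \<open>j\<close>, the remaining entries are the arguments of its guard, and
    \<open>m\<close> selects an element of the enumerated value.\<close>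
  define step where "step E ys = (\<Union>n m. R (\<lambda>j. from_nat_into (E (j # take n ys)) m) (drop n ys))"
    for E :: "'a list \<Rightarrow> 'a set" and ys
  \<comment> \<open>Stage \<open>Suc k\<close> guards only against functions read off from stage
    \<open>k\<close>, which avoids circularity. The union of all stages then guards against every
    one of them.\<close>
  define E where "E = rec_nat set (\<lambda>_ E xs. \<Union>ys\<in>lists (E xs). E ys \<union> step E ys)"
  have E0: "E 0 xs = set xs" for xs by (simp add: E_def)
  have ESuc: "E (Suc k) xs = (\<Union>ys\<in>lists (E k xs). E k ys \<union> step (E k) ys)" for k xs
    by (simp add: E_def)
  have Ecount: "countable (E k xs)" for k xs
  proof (induction k arbitrary: xs)
    case 0
    then show ?case by (simp add: E0 countable_finite)
  next
    case (Suc k)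
    have "countable (step (E k) ys)" for ys
      unfolding step_def by (intro countable_UN Rcount countableI_type)
    then show ?case unfolding ESuc by (intro countable_UN countable_Un countable_lists Suc.IH)
  qed
  have Emono: "E k xs \<subseteq> E k ys" if "set xs \<subseteq> set ys" for k xs ys
    using that
  proof (induction k arbitrary: xs ys)
    case (Suc k)
    from Suc.IH[OF Suc.prems] have "lists (E k xs) \<subseteq> lists (E k ys)" by (rule lists_mono)
    then show ?case unfolding ESuc by (rule UN_mono) (rule subset_refl)
  qed (simp add: E0)
  have Eset: "set xs \<subseteq> E k xs" for k xs
  proof (induction k arbitrary: xs)
    case (Suc k)
    have "xs \<in> lists (E k xs)" using Suc[of xs] by (simp add: in_lists_conv_set subset_iff)
    then have "E k xs \<subseteq> E (Suc k) xs" unfolding ESuc by blast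
    then show ?case using Suc[of xs] by (rule subset_trans[rotated])
  qed (simp add: E0)
  have Elists: "xs \<in> lists (E k xs)" for k xs
    using Eset[of xs k] by (simp add: in_lists_conv_set subset_iff)
  have Estep: "E k ys \<subseteq> E (Suc k) xs" "step (E k) ys \<subseteq> E (Suc k) xs" if "ys \<in> lists (E k xs)" for k xs ys
    using that unfolding ESuc by blast+
  have Ele: "E k xs \<subseteq> E l xs" if "k \<le> l" for k l xs
    using that
  proof (induction rule: dec_induct)
    case (step n)
    from step.IH Estep(1)[OF Elists[of xs n]] show ?case by (rule subset_trans)
  qed simp
  define K where "K xs = (\<Union>k. E k xs)" for xs
  have Kmono: "K xs \<subseteq> K ys" if "set xs \<subseteq> set ys" for xs ys
    unfolding K_def using Emono[OF that] by (intro UN_mono subset_refl)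
  have Kset: "set xs \<subseteq> K xs" for xs unfolding K_def using Eset[of xs 0] by blast
  have Kclosed: "closed_under K (\<Union>(K ` lists S))" for S
    unfolding closed_under_def
  proof
    fix ys assume ys: "ys \<in> lists (\<Union>(K ` lists S))"
    \<comment> \<open>The entries of \<open>ys\<close> may come from different stages and different
      lists; the maximum of the stages and the concatenation of the lists cover all of them.\<close>
    have "\<exists>k. \<exists>xs\<in>lists S. ys \<in> lists (E k xs)"
      using ys
    proof (induction ys)
      case Nil
      have "[] \<in> lists (E 0 [])" "[] \<in> lists S" by simp_all
      then show ?case by blast
    next
      case (Cons y ys)
      then obtain k xs where k: "xs \<in> lists S" "ys \<in> lists (E k xs)" by blast
      from Cons obtain xs' where xs': "xs' \<in> lists S" "y \<in> K xs'" by blast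
      then obtain l where l: "xs' \<in> lists S" "y \<in> E l xs'" unfolding K_def by blast
      have "E k xs \<subseteq> E (max k l) (xs @ xs')"
        by (rule subset_trans[OF Ele[of k "max k l"] Emono]) simp_all
      moreover have "E l xs' \<subseteq> E (max k l) (xs @ xs')"
        by (rule subset_trans[OF Ele[of l "max k l"] Emono]) simp_all
      ultimately have "y # ys \<in> lists (E (max k l) (xs @ xs'))"
        using k(2) l(2) by (simp add: in_lists_conv_set subset_iff)
      moreover have "xs @ xs' \<in> lists S" using k l by simp
      ultimately show ?case by blast
    qed
    then obtain k xs where k: "xs \<in> lists S" "ys \<in> lists (E k xs)" by blast
    have "E l ys \<subseteq> K xs" for l
    proof -
      have "ys \<in> lists (E (max k l) xs)" using k(2) Ele[of k "max k l" xs] by (simp add: in_lists_conv_set subset_iff)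
      then have "E (max k l) ys \<subseteq> E (Suc (max k l)) xs" by (rule Estep)
      moreover have "E l ys \<subseteq> E (max k l) ys" by (rule Ele) simp
      moreover have "E (Suc (max k l)) xs \<subseteq> K xs" unfolding K_def by (rule UN_upper) simp
      ultimately show ?thesis by (meson subset_trans)
    qed
    then have "K ys \<subseteq> K xs" unfolding K_def[of ys] by (rule UN_least)
    also have "\<dots> \<subseteq> \<Union>(K ` lists S)" using k(1) by (rule UN_upper)
    finally show "K ys \<subseteq> \<Union>(K ` lists S)" .
  qed
  have fin: "finite (nbrs_in adj M (component adj (V - M) u))"
    if M: "closed_under K M" and u: "u \<in> U" "u \<in> V - M" for M u
  proof -
    define D where "D = component adj (V - M) u"
    have DV: "D \<subseteq> V - M" unfolding D_def using u(2) by (rule component_subset)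
    have uD: "u \<in> D" by (simp add: D_def)
    \<comment> \<open>In a maximal closed set \<open>N\<close> missing \<open>D\<close>, adding the least vertex \<open>\<xi>\<close> outside \<open>N\<close> generates
      some \<open>d \<in> D\<close>; the dependence of \<open>d\<close> on \<open>\<xi>\<close> is the function \<open>\<delta>\<close> against which \<open>R\<close> guards.\<close>
    define \<C> where "\<C> = {N. closed_under K N \<and> M \<subseteq> N \<and> N \<inter> D = {}}"
    have "\<exists>N\<in>\<C>. \<forall>X\<in>\<C>. N \<subseteq> X \<longrightarrow> X = N"
    proof (rule subset_Zorn_nonempty)
      have "M \<in> \<C>" using M DV by (auto simp: \<C>_def)
      then show "\<C> \<noteq> {}" by blast
      fix C assume "C \<noteq> {}" "subset.chain \<C> C"
      then have C: "C \<subseteq> \<C>" "\<And>X Y. X \<in> C \<Longrightarrow> Y \<in> C \<Longrightarrow> X \<subseteq> Y \<or> Y \<subseteq> X"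
        by (auto simp: subset_chain_def)
      have "closed_under K (\<Union>C)"
        by (rule closed_under_Union_chain) (use C \<open>C \<noteq> {}\<close> in \<open>auto simp: \<C>_def\<close>)
      moreover have "M \<subseteq> \<Union>C" "\<Union>C \<inter> D = {}" using C(1) \<open>C \<noteq> {}\<close> unfolding \<C>_def by blast+
      ultimately show "\<Union>C \<in> \<C>" by (simp add: \<C>_def)
    qed
    then obtain N where N: "N \<in> \<C>" and max: "\<And>X. X \<in> \<C> \<Longrightarrow> N \<subseteq> X \<Longrightarrow> X = N" by blast
    have Ncl: "closed_under K N" and MN: "M \<subseteq> N" and ND: "N \<inter> D = {}" using N by (auto simp: \<C>_def)
    have DN: "D \<subseteq> V - N" using DV ND by blast
    have D: "component adj (V - N) u = D"
    proof
      show "component adj (V - N) u \<subseteq> D" unfolding D_def by (rule component_mono) (use MN in blast)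
      have "conn adj D" unfolding D_def by (rule conn_component)
      then show "D \<subseteq> component adj (V - N) u" using DN uD by (rule conn_subset_component)
    qed
    have "u \<in> - N" using uD ND by blast
    from wf[unfolded wf_eq_minimal, THEN spec, THEN spec, THEN mp, OF this]
    obtain \<xi> where \<xi>: "\<xi> \<notin> N" "\<forall>j. (j, \<xi>) \<in> lt \<longrightarrow> j \<in> N" by auto
    define T where "T = \<Union>(K ` lists (insert \<xi> N))"
    have sub: "insert \<xi> N \<subseteq> T"
    proof
      fix x assume "x \<in> insert \<xi> N"
      then have "[x] \<in> lists (insert \<xi> N)" by simp
      moreover have "x \<in> K [x]" using Kset[of "[x]"] by simp
      ultimately show "x \<in> T" unfolding T_def by blast
    qed
    have "T \<notin> \<C>"
    proof
      assume "T \<in> \<C>"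
      then have "T = N" using sub by (intro max) auto
      then show False using sub \<xi>(1) by blast
    qed
    moreover have "closed_under K T" unfolding T_def by (rule Kclosed)
    ultimately have "T \<inter> D \<noteq> {}" using sub MN by (auto simp: \<C>_def)
    then obtain d where "d \<in> D" "d \<in> T" by blast
    then obtain xs where xs: "xs \<in> lists (insert \<xi> N)" "d \<in> K xs" unfolding T_def by blast
    \<comment> \<open>All entries other than \<open>\<xi>\<close> lie in \<open>N\<close>.
      Monotonicity of \<open>K\<close> allows \<open>\<xi>\<close> to stand first, the position that
      \<open>step\<close> varies.\<close>
    define a where "a = filter (\<lambda>x. x \<noteq> \<xi>) xs"
    have a: "a \<in> lists N" using xs(1) by (auto simp: a_def)
    have "K xs \<subseteq> K (\<xi> # a)" by (rule Kmono) (auto simp: a_def)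
    then obtain k where k: "d \<in> E k (\<xi> # a)" using xs(2) unfolding K_def by blast
    define m where "m = to_nat_on (E k (\<xi> # a)) d"
    define \<delta> where "\<delta> j = from_nat_into (E k (j # a)) m" for j
    have \<delta>\<xi>: "\<delta> \<xi> = d" unfolding \<delta>_def m_def using Ecount k by (rule from_nat_into_to_nat_on)
    have "closed_under (R \<delta>) N" unfolding closed_under_def
    proof
      fix zs assume zs: "zs \<in> lists N"
      \<comment> \<open>Splitting \<open>a @ zs\<close> after \<open>length a\<close> entries
        exhibits \<open>R \<delta> zs\<close> as one of the sets collected by
        \<open>step\<close>.\<close>
      have \<delta>: "\<delta> = (\<lambda>j. from_nat_into (E k (j # take (length a) (a @ zs))) m)"
        by (rule ext) (simp add: \<delta>_def)
      have zs': "zs = drop (length a) (a @ zs)" by simp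
      have "R \<delta> zs \<subseteq> step (E k) (a @ zs)"
      proof
        fix x assume "x \<in> R \<delta> zs"
        then have "x \<in> R (\<lambda>j. from_nat_into (E k (j # take (length a) (a @ zs))) m) (drop (length a) (a @ zs))"
          unfolding \<delta> by simp
        then show "x \<in> step (E k) (a @ zs)" unfolding step_def by (intro UN_I UNIV_I)
      qed
      also have "\<dots> \<subseteq> E (Suc k) (a @ zs)" by (rule Estep(2)[OF Elists])
      also have "\<dots> \<subseteq> K (a @ zs)" unfolding K_def by blast
      also have "\<dots> \<subseteq> N"
      proof -
        have "a @ zs \<in> lists N" using a zs by simp
        with Ncl[unfolded closed_under_def] show ?thesis by (rule bspec)
      qed
      finally show "R \<delta> zs \<subseteq> N" .
    qed
    moreover have "u \<in> V - N" "\<delta> \<xi> \<in> component adj (V - N) u"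
      using uD DN \<delta>\<xi> \<open>d \<in> D\<close> D by auto
    moreover have "closed_under (R \<delta>) N \<longrightarrow> \<xi> \<notin> N \<longrightarrow> (\<forall>j. (j, \<xi>) \<in> lt \<longrightarrow> j \<in> N) \<longrightarrow>
      u \<in> U \<longrightarrow> u \<in> V - N \<longrightarrow> \<delta> \<xi> \<in> component adj (V - N) u \<longrightarrow>
      finite (nbrs_in adj N (component adj (V - N) u))"
      using R[THEN spec, of \<delta>, unfolded step_ok_def, THEN conjunct2, THEN spec, THEN spec, THEN spec] .
    ultimately have "finite (nbrs_in adj N (component adj (V - N) u))"
      using \<xi> u(1) by (elim impE)
    then show ?thesis unfolding D D_def[symmetric]
      using nbrs_in_mono[OF MN subset_refl] by (rule finite_subset[rotated])
  qed
  have Kcount: "countable (K xs)" for xs unfolding K_def using Ecount by (intro countable_UN) simp_all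
  show ?thesis using Kcount Kset Kmono Kclosed fin by (intro exI[of _ K]) simp
qed

end

section \<open>Growing a normal tree\<close>

lemma gpath_rev:
  assumes "gpath S adj p" "\<And>x y. adj x y \<Longrightarrow> adj y x"
  shows "gpath S adj (rev p)"
  using assms(1)
proof (induction p rule: induct_list012)
  case (3 x y p)
  then have "gpath S adj (rev (y # p) @ [x])"
    by (intro gpath_append) (auto simp: gpath_Cons gpath_single intro: assms(2))
  then show ?case by simp
qed simp_all

lemma gpath_hd_eq_last: "gpath S adj p \<Longrightarrow> hd p = last p \<Longrightarrow> p = [hd p]"
  by (cases p) (auto simp: gpath_def split: if_splits)

text \<open>\<open>P x y\<close> makes \<open>x\<close> the parent of \<open>y\<close>. Unique
  parents together with a strictly increasing height exclude cycles; connectedness is added in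
  \<open>is_treeI\<close>.\<close>

locale parent_tree =
  fixes VT :: "'a set" and P :: "'a \<Rightarrow> 'a \<Rightarrow> bool" and h :: "'a \<Rightarrow> nat" and adjT :: "'a \<Rightarrow> 'a \<Rightarrow> bool"
  assumes VT: "VT \<noteq> {}"
    and P_VT: "P x y \<Longrightarrow> x \<in> VT \<and> y \<in> VT"
    and P_unique: "P x z \<Longrightarrow> P y z \<Longrightarrow> x = y"
    and P_height: "P x y \<Longrightarrow> h x < h y"
    and adjT: "adjT x y \<longleftrightarrow> P x y \<or> P y x"
begin

text \<open>After a step from a parent to its child, the path cannot return to the only parent of
  that child, so every further step also leads to a child.\<close>

lemma height_less_last:
  "gpath VT adjT (x # c # p) \<Longrightarrow> P x c \<Longrightarrow> h x < h (last (c # p))"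
proof (induction p arbitrary: x c)
  case Nil
  then show ?case by (simp add: P_height)
next
  case (Cons d p)
  have "adjT c d" "d \<noteq> x" "gpath VT adjT (c # d # p)" using Cons.prems(1) by (auto simp: gpath_Cons)
  moreover have "P c d" using calculation P_unique[OF _ Cons.prems(2)] adjT by blast
  ultimately have "h c < h (last (d # p))" using Cons.IH by blast
  then show ?case using P_height[OF Cons.prems(2)] by simp
qed

text \<open>A nontrivial path that ends no higher than it starts must begin with the step to the
  parent, by \<open>height_less_last\<close>. Two such paths with the same ends share this step, and
  induction treats the rest; in the other case both paths are reversed.\<close>

lemma gpath_unique:
  "gpath VT adjT p \<Longrightarrow> gpath VT adjT q \<Longrightarrow> hd p = hd q \<Longrightarrow> last p = last q \<Longrightarrow> p = q"
proof (induction "length p + length q" arbitrary: p q rule: less_induct)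
  case less
  \<comment> \<open>Only the total length is prescribed, so that the claim applies to the reversed
    paths as well.\<close>
  have main: "p' = q'" if p': "gpath VT adjT p'" and q': "gpath VT adjT q'" and
    eq: "hd p' = hd q'" "last p' = last q'" and
    len: "length p' + length q' = length p + length q" and le: "h (last p') \<le> h (hd p')" for p' q'
  proof (cases "hd p' = last p'")
    case True
    then show ?thesis using gpath_hd_eq_last[OF p'] gpath_hd_eq_last[OF q'] eq by metis
  next
    case False
    have first: "\<exists>c s. r = hd r # c # s \<and> P c (hd r) \<and> gpath VT adjT (c # s)"
      if r: "gpath VT adjT r" "hd r \<noteq> last r" "h (last r) \<le> h (hd r)" for r
    proof -
      from r(1,2) obtain x c s where rs: "r = x # c # s"
        by (cases r rule: remdups_adj.cases) (auto simp: gpath_def)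
      have "\<not> P x c" using height_less_last[of x c s] r rs by auto
      moreover have "adjT x c" "gpath VT adjT (c # s)" using r rs by (auto simp: gpath_Cons)
      ultimately show ?thesis using rs adjT by auto
    qed
    obtain c s where c: "p' = hd p' # c # s" "P c (hd p')" "gpath VT adjT (c # s)"
      using first[OF p' False le] by blast
    obtain d t where d: "q' = hd q' # d # t" "P d (hd q')" "gpath VT adjT (d # t)"
      using first[OF q'] False le eq by auto
    have "c = d" using P_unique c d eq by simp
    have len': "length p' = Suc (length (c # s))" "length q' = Suc (length (d # t))"
      by (subst c(1), simp) (subst d(1), simp)
    have last': "last p' = last (c # s)" "last q' = last (d # t)"
      by (subst c(1), simp) (subst d(1), simp)
    have "c # s = d # t"
    proof (rule less.hyps)
      show "length (c # s) + length (d # t) < length p + length q"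
        unfolding len[symmetric] len' by simp
      show "last (c # s) = last (d # t)"
        using eq(2) unfolding last' .
    qed (use c d \<open>c = d\<close> in simp_all)
    then show ?thesis using c(1) d(1) eq(1) by simp
  qed
  have sym: "adjT x y \<Longrightarrow> adjT y x" for x y by (auto simp: adjT)
  have ne: "p \<noteq> []" "q \<noteq> []" using less.prems by (auto simp: gpath_def)
  show ?case
  proof (cases "h (last p) \<le> h (hd p)")
    case True
    then show ?thesis using main less.prems by blast
  next
    case False
    have "rev p = rev q"
    proof (rule main)
      show "gpath VT adjT (rev p)" "gpath VT adjT (rev q)" using less.prems gpath_rev sym by blast+
    qed (use less.prems False ne in \<open>simp_all add: hd_rev last_rev\<close>)
    then show ?thesis by simp
  qed
qed

lemma is_treeI:
  assumes "\<And>x. x \<in> VT \<Longrightarrow> (edge_in adjT VT)\<^sup>*\<^sup>* r x"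
  shows "is_tree VT adjT"
proof -
  have sym: "adjT x y \<Longrightarrow> adjT y x" for x y by (auto simp: adjT)
  have "graph VT adjT" using P_VT P_height by (fastforce simp: graph_def adjT)
  moreover have "\<exists>!p. gpath VT adjT p \<and> hd p = x \<and> last p = y" if xy: "x \<in> VT" "y \<in> VT" for x y
  proof -
    have "(edge_in adjT VT)\<^sup>*\<^sup>* x r" by (rule reach_sym[OF sym assms[OF xy(1)]])
    then have "(edge_in adjT VT)\<^sup>*\<^sup>* x y" using assms[OF xy(2)] by (rule rtranclp_trans)
    then obtain p where p: "gpath VT adjT p" "hd p = x" "last p = y" using xy(1) by (rule reach_gpath)
    show ?thesis
    proof (rule ex1I[of _ p])
      fix q assume "gpath VT adjT q \<and> hd q = x \<and> last q = y"
      then show "q = p" using p by (intro gpath_unique) simp_all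
    qed (use p in simp)
  qed
  ultimately show ?thesis using VT by (simp add: is_tree_def)
qed

end

section \<open>The tree: choice of successors, root paths, normality\<close>

locale adhesion_closure =
  fixes V :: "'a set" and adj :: "'a \<Rightarrow> 'a \<Rightarrow> bool" and U :: "'a set" and K :: "'a list \<Rightarrow> 'a set"
  assumes graph: "graph V adj" and connV: "conn adj V" and UV: "U \<subseteq> V"
    and K_countable: "countable (K xs)" and K_superset: "set xs \<subseteq> K xs"
    and K_mono: "set xs \<subseteq> set ys \<Longrightarrow> K xs \<subseteq> K ys"
    and K_closed: "closed_under K (\<Union>(K ` lists S))"
    and finite_adhesion: "closed_under K M \<Longrightarrow> u \<in> U \<Longrightarrow> u \<in> V - M \<Longrightarrow>
      finite (nbrs_in adj M (component adj (V - M) u))"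
begin

lemma sym: "adj x y \<Longrightarrow> adj y x"
  and adj_V: "adj x y \<Longrightarrow> x \<in> V" "adj x y \<Longrightarrow> y \<in> V"
  using graph by (auto simp: graph_def)

lemma component_eq: "y \<in> component adj S x \<Longrightarrow> component adj S y = component adj S x"
  by (rule component_eq[of adj]) (rule sym)

lemma conn_component: "conn adj (component adj S x)"
  by (rule conn_component[of adj]) (rule sym)

text \<open>
The index \<open>i\<close> encodes a pair \<open>(k, m)\<close>, standing for the \<open>m\<close>-th element of the closure of the first \<open>k\<close>
entries; its meaning is stable once \<open>L\<close> has at least \<open>k\<close> entries. An empty closure yields a junk
target, which does no harm since targets are only used when they lie in \<open>C\<close>.
\<close>
definition enum :: "nat \<Rightarrow> 'a list \<Rightarrow> 'a" where
  "enum i L = from_nat_into (K (take (fst (prod_decode i)) L)) (snd (prod_decode i))"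

text \<open>Taking the least index gives early entries of the enumeration priority. If no enumerated
  vertex lies in \<open>C\<close>, the value is arbitrary, and \<open>next_vertex\<close> treats
  that case separately.\<close>

definition target :: "'a list \<Rightarrow> 'a set \<Rightarrow> 'a" where
  "target L C = enum (LEAST i. enum i L \<in> C) L"

definition at_dist :: "'a list \<Rightarrow> 'a set \<Rightarrow> nat \<Rightarrow> 'a \<Rightarrow> bool" where
  "at_dist L C n y \<longleftrightarrow> y \<in> C \<and> adj (last L) y \<and> (edge_in adj C ^^ n) y (target L C)"

definition dist_target :: "'a list \<Rightarrow> 'a set \<Rightarrow> nat" where
  "dist_target L C = (LEAST n. \<exists>y. at_dist L C n y)"

text \<open>Among the neighbours of \<open>last L\<close> in \<open>C\<close>, one nearest to the
  target is taken. The choice depends on \<open>L\<close> and \<open>C\<close> alone, so each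
  component beyond \<open>L\<close> receives only one child of \<open>last L\<close>; normality
  rests on this.\<close>

definition next_vertex :: "'a list \<Rightarrow> 'a set \<Rightarrow> 'a" where
  "next_vertex L C = (if \<exists>i. enum i L \<in> C then SOME y. at_dist L C (dist_target L C) y
     else SOME y. y \<in> C \<and> adj (last L) y)"

lemma target_in: "enum i L \<in> C \<Longrightarrow> target L C \<in> C"
  unfolding target_def by (rule LeastI)

lemma at_dist_next:
  assumes "conn adj C" "\<exists>y\<in>C. adj (last L) y" "enum i L \<in> C"
  shows "at_dist L C (dist_target L C) (next_vertex L C)"
proof -
  obtain y where y: "y \<in> C" "adj (last L) y" using assms(2) by blast
  have "(edge_in adj C)\<^sup>*\<^sup>* y (target L C)"
    using assms(1) y(1) target_in[OF assms(3)] by (simp add: conn_def)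
  then obtain n where "(edge_in adj C ^^ n) y (target L C)" by (auto dest: rtranclp_imp_relpowp)
  then have "\<exists>y. at_dist L C n y" using y by (auto simp: at_dist_def)
  then have "\<exists>y. at_dist L C (dist_target L C) y" unfolding dist_target_def by (rule LeastI)
  then have "at_dist L C (dist_target L C) (SOME y. at_dist L C (dist_target L C) y)" by (rule someI_ex)
  moreover have "next_vertex L C = (SOME y. at_dist L C (dist_target L C) y)"
    using assms(3) by (auto simp: next_vertex_def)
  ultimately show ?thesis by simp
qed

lemma next_vertex_in:
  assumes "conn adj C" "\<exists>y\<in>C. adj (last L) y"
  shows "next_vertex L C \<in> C" "adj (last L) (next_vertex L C)"
proof -
  have "next_vertex L C \<in> C \<and> adj (last L) (next_vertex L C)"
  proof (cases "\<exists>i. enum i L \<in> C")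
    case True
    then show ?thesis using at_dist_next[OF assms] by (auto simp: at_dist_def)
  next
    case False
    have "\<exists>y. y \<in> C \<and> adj (last L) y" using assms(2) by blast
    from someI_ex[OF this] show ?thesis using False by (simp add: next_vertex_def)
  qed
  then show "next_vertex L C \<in> C" "adj (last L) (next_vertex L C)" by auto
qed

definition root :: 'a where "root = (SOME r. r \<in> V)"

lemma root_in: "root \<in> V"
  unfolding root_def using connV by (intro some_in_eq[THEN iffD2]) (simp add: conn_def)

text \<open>This is the region of the graph in which the part of the tree above
  \<open>last L\<close> grows.\<close>

definition cone :: "'a list \<Rightarrow> 'a set" where
  "cone L = component adj (V - set (butlast L)) (last L)"

text \<open>The lists in \<open>pos\<close> are the paths of the tree starting at the root.\<close>
inductive pos :: "'a list \<Rightarrow> bool" where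
  root: "pos [root]"
| step: "pos L \<Longrightarrow> u \<in> U \<Longrightarrow> u \<in> cone L \<Longrightarrow> u \<noteq> last L \<Longrightarrow>
    pos (L @ [next_vertex L (component adj (V - set L) u)])"

text \<open>If \<open>y\<close> had no neighbour in it, the component of \<open>u\<close> in
  \<open>C - {y}\<close> would be closed under all edges of \<open>C\<close>, so by connectedness it
  would contain \<open>y\<close>.\<close>

lemma component_meets_neighbour:
  assumes "conn adj C" "y \<in> C" "u \<in> C" "u \<noteq> y"
  shows "\<exists>z\<in>component adj (C - {y}) u. adj y z"
proof (rule ccontr)
  assume neg: "\<not> ?thesis"
  let ?X = "component adj (C - {y}) u"
  have u: "u \<in> C - {y}" using assms by simp
  have "component adj C u \<subseteq> ?X"
  proof (rule component_least)
    fix z w assume zw: "z \<in> ?X" "adj z w" "w \<in> C"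
    have "w \<noteq> y" using neg zw(1) sym[OF zw(2)] by blast
    then show "w \<in> ?X" using component_step[OF zw(1,2) _ u] zw(3) by simp
  qed simp
  moreover have "y \<in> component adj C u"
    using conn_subset_component[OF assms(1) subset_refl assms(3)] assms(2) by blast
  ultimately show False using component_subset[OF u, of adj] by blast
qed

lemma gpath_cone:
  assumes "gpath V adj L"
  shows "last L \<in> V - set (butlast L)" "L = butlast L @ [last L]"
proof -
  have "L \<noteq> []" using assms by (auto simp: gpath_def)
  then show *: "L = butlast L @ [last L]" by simp
  have "distinct (butlast L @ [last L])" "set (butlast L @ [last L]) \<subseteq> V"
    using assms unfolding *[symmetric] by (simp_all add: gpath_def)
  then show "last L \<in> V - set (butlast L)" by simp
qed

text \<open>Since \<open>cone L\<close> is connected, the component \<open>C\<close> of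
  \<open>u\<close> beyond \<open>L\<close> contains a neighbour of \<open>last L\<close>. The new
  vertex is chosen in \<open>C\<close>, so its cone is all of \<open>C\<close>.\<close>

lemma cone_step:
  assumes "gpath V adj L" "u \<in> cone L" "u \<noteq> last L"
  defines "C \<equiv> component adj (V - set L) u"
  shows "u \<in> V - set L" "\<exists>y\<in>C. adj (last L) y" "next_vertex L C \<in> C" "adj (last L) (next_vertex L C)"
    "gpath V adj (L @ [next_vertex L C])" "cone (L @ [next_vertex L C]) = C"
proof -
  have L: "set L = insert (last L) (set (butlast L))"
    by (subst gpath_cone(2)[OF assms(1)]) (simp del: append_butlast_last_id)
  have sub: "cone L \<subseteq> V - set (butlast L)"
    unfolding cone_def by (rule component_subset) (rule gpath_cone(1)[OF assms(1)])
  then have sub': "cone L - {last L} \<subseteq> V - set L" unfolding L by blast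
  then show u: "u \<in> V - set L" using assms(2,3) by blast
  have "last L \<in> cone L" by (simp add: cone_def)
  moreover have "conn adj (cone L)" unfolding cone_def by (rule conn_component)
  ultimately obtain z where z: "z \<in> component adj (cone L - {last L}) u" "adj (last L) z"
    using component_meets_neighbour assms(2,3) by blast
  then have "z \<in> C" using component_mono[OF sub', of adj u] by (auto simp: C_def)
  then show ex: "\<exists>y\<in>C. adj (last L) y" using z(2) by blast
  have "conn adj C" unfolding C_def by (rule conn_component)
  note nv = next_vertex_in[OF this ex]
  from nv show "next_vertex L C \<in> C" "adj (last L) (next_vertex L C)" .
  have "C \<subseteq> V - set L" unfolding C_def using u by (rule component_subset)
  then show "gpath V adj (L @ [next_vertex L C])"
    using assms(1) nv by (intro gpath_append) (auto simp: gpath_single)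
  show "cone (L @ [next_vertex L C]) = C"
    using nv(1) component_eq[of "next_vertex L C" "V - set L" u] by (simp add: cone_def C_def)
qed

lemma pos_gpath: "pos L \<Longrightarrow> gpath V adj L \<and> hd L = root"
proof (induction rule: pos.induct)
  case root
  then show ?case by (simp add: gpath_single root_in)
next
  case (step L u)
  have "L \<noteq> []" using step.IH by (auto simp: gpath_def)
  then show ?case using step cone_step(5)[of L u] by simp
qed

text \<open>The vertex \<open>u\<close> that prompted the extension and the new vertex
  \<open>x\<close> lie in the same component beyond \<open>L\<close>, so \<open>x\<close> can take
  the place of \<open>u\<close> in the description of \<open>x\<close>.\<close>

lemma pos_snocD:
  assumes "pos (L @ [x])" "L \<noteq> []"
  shows "pos L" "x = next_vertex L (component adj (V - set L) x)"
proof -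
  from assms have "pos L \<and> x = next_vertex L (component adj (V - set L) x)"
  proof cases
    case (step L' u)
    then have L': "L' = L" "x = next_vertex L (component adj (V - set L) u)" by auto
    have "x \<in> component adj (V - set L) u"
      unfolding L'(2) using step pos_gpath L' by (intro cone_step(3)) auto
    then have "component adj (V - set L) x = component adj (V - set L) u" by (rule component_eq)
    then show ?thesis using L' step by simp
  qed (use assms in simp)
  then show "pos L" "x = next_vertex L (component adj (V - set L) x)" by auto
qed

lemma pos_prefix: "pos (L @ L') \<Longrightarrow> L \<noteq> [] \<Longrightarrow> pos L"
proof (induction L' rule: rev_induct)
  case (snoc x L')
  then show ?case using pos_snocD(1)[of "L @ L'" x] by simp
qed simp

lemma pos_tail_component:
  assumes "pos (L @ y # L')"
  shows "set (y # L') \<subseteq> component adj (V - set L) y"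
proof -
  have g: "gpath V adj (L @ y # L')" using pos_gpath[OF assms] by simp
  then have "gpath V adj (y # L')" by (rule gpath_appendD2) simp
  then have "conn adj (set (y # L'))" using sym by (intro conn_gpath)
  moreover have "set (y # L') \<subseteq> V - set L" using g by (auto simp: gpath_def)
  ultimately show ?thesis by (rule conn_subset_component) simp
qed

text \<open>By \<open>pos_snocD\<close>, distinct successors \<open>x\<close> and \<open>y\<close>
  of the same \<open>L\<close> lie in distinct components of \<open>V - set L\<close>, and the
  continuations of the two paths stay in these components.\<close>

lemma pos_separated:
  assumes "pos (L @ x # L1)" "pos (L @ y # L2)" "x \<noteq> y" "a \<in> set (x # L1)" "b \<in> set (y # L2)"
  shows "b \<notin> component adj (V - set L) a" "L \<noteq> []"
proof -
  show L: "L \<noteq> []"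
  proof
    assume "L = []"
    then have "x = root" "y = root" using pos_gpath assms(1,2) by fastforce+
    then show False using assms(3) by simp
  qed
  have "pos (L @ [x])" "pos (L @ [y])"
    using pos_prefix[of "L @ [x]" L1] pos_prefix[of "L @ [y]" L2] assms(1,2) by simp_all
  from pos_snocD(2)[OF this(1) L] pos_snocD(2)[OF this(2) L]
  have ne: "component adj (V - set L) x \<noteq> component adj (V - set L) y"
    using assms(3) by (elim contrapos_nn) simp
  have "component adj (V - set L) a = component adj (V - set L) x"
    using pos_tail_component[OF assms(1)] assms(4) by (intro component_eq) blast
  moreover have "component adj (V - set L) b = component adj (V - set L) y"
    using pos_tail_component[OF assms(2)] assms(5) by (intro component_eq) blast
  ultimately show "b \<notin> component adj (V - set L) a"
    using ne component_eq[of b "V - set L" a] by auto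
qed

text \<open>If one path extends the other, distinctness of vertices forces equality. Otherwise the
  paths branch, and \<open>pos_separated\<close> shows that their last vertices differ.\<close>

lemma pos_last_inj:
  assumes "pos L" "pos L'" "last L = last L'"
  shows "L = L'"
proof -
  have *: "L = L'" if P: "pos L" "pos L'" "last L = last L'" "prefix L L'" for L L'
  proof -
    obtain zs where zs: "L' = L @ zs" using P(4) by (auto simp: prefix_def)
    have L: "L \<noteq> []" "distinct L'" using pos_gpath P(1,2) by (auto simp: gpath_def)
    have "zs = []"
    proof (rule ccontr)
      assume "zs \<noteq> []"
      then have "last L' \<in> set zs" using zs by simp
      moreover have "last L' \<in> set L" using P(3) L(1) by (metis last_in_set)
      ultimately show False using L(2) zs by auto
    qed
    then show ?thesis using zs by simp
  qed
  consider "prefix L L'" | "prefix L' L" | "L \<parallel> L'" by blast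
  then show ?thesis
  proof cases
    case 1
    then show ?thesis using * assms by blast
  next
    case 2
    then show ?thesis using *[of L' L] assms by simp
  next
    case 3
    then obtain as x bs y cs where d: "x \<noteq> y" "L = as @ x # bs" "L' = as @ y # cs"
      using parallel_decomp by blast
    have "last L' \<notin> component adj (V - set as) (last L)"
      using pos_separated(1)[of as x bs y cs "last L" "last L'"] assms(1,2) d by simp
    then show ?thesis using assms(3) by simp
  qed
qed

definition VT :: "'a set" where "VT = \<Union>(set ` Collect pos)"

definition parent :: "'a \<Rightarrow> 'a \<Rightarrow> bool" where "parent x y \<longleftrightarrow> (\<exists>L. pos (L @ [x, y]))"

definition adjT :: "'a \<Rightarrow> 'a \<Rightarrow> bool" where "adjT x y \<longleftrightarrow> parent x y \<or> parent y x"

definition path_to :: "'a \<Rightarrow> 'a list" where "path_to x = (THE L. pos L \<and> last L = x)"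

lemma path_to_last: "pos L \<Longrightarrow> path_to (last L) = L"
  unfolding path_to_def using pos_last_inj by (intro the_equality) auto

lemma pos_path_to:
  assumes "x \<in> VT"
  shows "pos (path_to x)" "last (path_to x) = x"
proof -
  obtain L where "pos L" "x \<in> set L" using assms by (auto simp: VT_def)
  then obtain L1 L2 where "pos ((L1 @ [x]) @ L2)" by (metis append.assoc append_Cons append_Nil split_list)
  then have "pos (L1 @ [x])" by (rule pos_prefix) simp
  then show "pos (path_to x)" "last (path_to x) = x" using path_to_last[of "L1 @ [x]"] by simp_all
qed

lemma parent_pos: "pos (L @ [x, y]) \<Longrightarrow> pos (L @ [x])"
  using pos_prefix[of "L @ [x]" "[y]"] by simp

sublocale parent_tree VT parent "\<lambda>x. length (path_to x)" adjT
proof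
  have "root \<in> VT" using pos.root by (force simp: VT_def)
  then show "VT \<noteq> {}" by blast
  show "x \<in> VT \<and> y \<in> VT" if "parent x y" for x y
    using that by (force simp: VT_def parent_def)
  show "x = y" if "parent x z" "parent y z" for x y z
    using that pos_last_inj by (fastforce simp: parent_def)
  show "length (path_to x) < length (path_to y)" if xy: "parent x y" for x y
  proof -
    obtain L where L: "pos (L @ [x, y])" using xy by (auto simp: parent_def)
    show ?thesis using path_to_last[OF L] path_to_last[OF parent_pos[OF L]] by simp
  qed
qed (simp add: adjT_def)

lemma pos_gpath_tree: "pos L \<Longrightarrow> gpath VT adjT L"
proof (induction rule: pos.induct)
  case root
  have "root \<in> VT" using pos.root by (force simp: VT_def)
  then show ?case by (simp add: gpath_single)
next
  case (step L u)
  let ?y = "next_vertex L (component adj (V - set L) u)"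
  have p: "pos (L @ [?y])" using step.hyps by (rule pos.step)
  have "L \<noteq> []" using step.IH by (auto simp: gpath_def)
  then have "pos (butlast L @ [last L, ?y])"
    using p by (metis append.assoc append_Cons append_Nil append_butlast_last_id)
  then have "adjT (last L) ?y" by (auto simp: adjT_def parent_def)
  moreover have "?y \<in> VT" using p by (force simp: VT_def)
  moreover have "?y \<notin> set L" using pos_gpath[OF p] by (auto simp: gpath_def)
  ultimately show ?case using step.IH by (intro gpath_append) (auto simp: gpath_single)
qed

lemma subtree_VT: "subtree V adj VT adjT"
proof -
  have "VT \<subseteq> V" using pos_gpath by (fastforce simp: VT_def gpath_def)
  moreover have "adj x y" if xy: "parent x y" for x y
  proof -
    obtain L where "pos (L @ [x, y])" using xy by (auto simp: parent_def)
    then have "gpath V adj [x, y]" using pos_gpath gpath_appendD2[of V adj L "[x, y]"] by simp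
    then show ?thesis by (simp add: gpath_Cons)
  qed
  moreover have "is_tree VT adjT"
  proof (rule is_treeI)
    fix x assume "x \<in> VT"
    note p = pos_path_to[OF this]
    show "(edge_in adjT VT)\<^sup>*\<^sup>* root x"
      using gpath_reach[OF pos_gpath_tree[OF p(1)]] pos_gpath[OF p(1)] p(2) by simp
  qed
  ultimately show ?thesis using sym by (auto simp: subtree_def adjT_def)
qed

text \<open>If the ends of a \<open>T\<close>-path are incomparable, their root paths branch after a
  common part \<open>as\<close>. The path avoids \<open>as\<close> and therefore joins both ends
  within \<open>V - set as\<close>, contrary to \<open>pos_separated\<close>.\<close>

lemma normal_tree_VT: "normal_tree V adj VT adjT root"
  unfolding normal_tree_def
proof (intro conjI allI impI)
  show "subtree V adj VT adjT" by (rule subtree_VT)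
  show "root \<in> VT" using pos.root by (force simp: VT_def)
  fix p assume "tpath V adj VT adjT p"
  then have p: "gpath V adj p" "hd p \<in> VT" "last p \<in> VT" "2 \<le> length p"
    and inner: "\<And>i. 0 < i \<Longrightarrow> Suc i < length p \<Longrightarrow> p ! i \<notin> VT" by (auto simp: tpath_def)
  let ?x = "hd p" and ?y = "last p"
  note X = pos_path_to[OF p(2)] and Y = pos_path_to[OF p(3)]
  have le: "tree_le VT adjT root z w" if "prefix (path_to z) (path_to w)" "z \<in> VT" "w \<in> VT" for z w
  proof -
    note Z = pos_path_to[OF that(2)] and W = pos_path_to[OF that(3)]
    have "path_to z \<noteq> []" using pos_gpath[OF Z(1)] by (auto simp: gpath_def)
    then have "z \<in> set (path_to w)" using Z(2) that(1) by (metis last_in_set set_mono_prefix subsetD)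
    then show ?thesis unfolding tree_le_def
      using pos_gpath_tree[OF W(1)] pos_gpath[OF W(1)] W(2) by (intro exI[of _ "path_to w"]) simp
  qed
  consider "prefix (path_to ?x) (path_to ?y)" | "prefix (path_to ?y) (path_to ?x)"
    | "path_to ?x \<parallel> path_to ?y" by blast
  then show "tree_le VT adjT root ?x ?y \<or> tree_le VT adjT root ?y ?x"
  proof cases
    case 3
    then obtain as x bs y cs where d: "x \<noteq> y" "path_to ?x = as @ x # bs" "path_to ?y = as @ y # cs"
      using parallel_decomp by blast
    have P: "pos (as @ x # bs)" "pos (as @ y # cs)" using X(1) Y(1) d by simp_all
    have xs: "?x \<in> set (x # bs)" "?y \<in> set (y # cs)" using X(2) Y(2) d by (metis last_appendR last_in_set list.distinct(1))+
    have as: "set as \<subseteq> VT" using P(1) by (force simp: VT_def)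
    have "set p \<subseteq> V - set as"
    proof
      fix z assume z: "z \<in> set p"
      then obtain i where i: "i < length p" "z = p ! i" by (auto simp: in_set_conv_nth)
      have ne: "p \<noteq> []" using p(4) by auto
      consider "z = ?x" | "z = ?y" | "0 < i" "Suc i < length p"
      proof -
        consider "i = 0" | "i = length p - 1" | "0 < i" "Suc i < length p" using i(1) by linarith
        then show thesis using that i ne by cases (auto simp: hd_conv_nth last_conv_nth)
      qed
      then have "z \<notin> set as"
      proof cases
        case 1
        then show ?thesis using xs(1) pos_gpath[OF P(1)] by (auto simp: gpath_def)
      next
        case 2
        then show ?thesis using xs(2) pos_gpath[OF P(2)] by (auto simp: gpath_def)
      next
        case 3
        then show ?thesis using inner i as by blast
      qed
      then show "z \<in> V - set as" using z p(1) by (auto simp: gpath_def)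
    qed
    moreover have "conn adj (set p)" using sym p(1) by (rule conn_gpath)
    ultimately have "?y \<in> component adj (V - set as) ?x"
      using conn_subset_component[of adj "set p" "V - set as" ?x] p(4) by (cases p) auto
    then show ?thesis using pos_separated(1)[OF P d(1) xs] by simp
  qed (use le p in blast)+
qed

end

section \<open>Every vertex of \<open>U\<close> is reached\<close>

lemma finite_subset_increasing_UN:
  fixes S :: "nat \<Rightarrow> 'a set"
  assumes "finite A" "A \<subseteq> (\<Union>n. S n)" "\<And>m n. m \<le> n \<Longrightarrow> S m \<subseteq> S n"
  shows "\<exists>n. A \<subseteq> S n"
  using assms(1,2)
proof (induction A)
  case (insert x A)
  then obtain m n where "A \<subseteq> S m" "x \<in> S n" by auto
  then have "insert x A \<subseteq> S (max m n)" using assms(3)[of m "max m n"] assms(3)[of n "max m n"] by auto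
  then show ?case by blast
qed simp

context adhesion_closure
begin

text \<open>A walk of length \<open>m\<close> from \<open>w\<close> to \<open>s\<close> through
  \<open>y\<close> would contain a walk from \<open>y\<close> to \<open>s\<close> of length at most
  \<open>m\<close>. So it avoids \<open>y\<close>, stays in \<open>S\<close>, and hence stays in the
  component containing \<open>s\<close>.\<close>

lemma relpow_avoid:
  assumes "(edge_in adj C ^^ m) w s" "s \<in> component adj S v" "v \<in> S" "C - {y} \<subseteq> S" "w \<in> C"
    and "\<And>k. k \<le> m \<Longrightarrow> \<not> (edge_in adj C ^^ k) y s"
  shows "w \<in> component adj S v \<and> (edge_in adj (component adj S v) ^^ m) w s"
  using assms(1,5,6)
proof (induction m arbitrary: w)
  case 0
  then show ?case using assms(2) by simp
next
  case (Suc m)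
  obtain w' where w': "edge_in adj C w w'" "(edge_in adj C ^^ m) w' s"
    using relpowp_Suc_D2[OF Suc.prems(1)] by blast
  have w'C: "w' \<in> C" "adj w w'" using w'(1) by (auto simp: edge_in_def)
  have "\<not> (edge_in adj C ^^ k) y s" if "k \<le> m" for k using Suc.prems(3)[of k] that by simp
  from Suc.IH[OF w'(2) w'C(1) this]
  have IH: "w' \<in> component adj S v" "(edge_in adj (component adj S v) ^^ m) w' s" by auto
  have "w \<noteq> y" using Suc.prems(1) Suc.prems(3)[of "Suc m"] by auto
  then have "w \<in> S" using Suc.prems(2) assms(4) by blast
  then have w: "w \<in> component adj S v" using component_step[OF IH(1) sym[OF w'C(2)] _ assms(3)] by simp
  then have "edge_in adj (component adj S v) w w'" using IH(1) w'C(2) by (simp add: edge_in_def)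
  then show ?case using w relpowp_Suc_I2 IH(2) by metis
qed

text \<open>The new vertex starts a shortest walk to \<open>s\<close>. The second vertex
  \<open>w\<close> of this walk is a neighbour of \<open>last L'\<close>, and by minimality the walk
  from \<open>w\<close> on avoids the new vertex, so it runs inside \<open>C'\<close> and is shorter
  by one.\<close>

lemma dist_target_decreases:
  assumes L: "gpath V adj L" and u: "u \<in> cone L" "u \<noteq> last L"
    and C_def: "C = component adj (V - set L) u" and L'_def: "L' = L @ [next_vertex L C]"
    and C'_def: "C' = component adj (V - set L') u" and u': "u \<notin> set L'" and i: "enum i L \<in> C" and s: "target L C = s" "target L' C' = s" "s \<in> C'"
  shows "dist_target L' C' < dist_target L C"
proof -
  let ?y = "next_vertex L C"
  note st = cone_step[OF L u, folded C_def L'_def]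
  have uL': "u \<in> V - set L'" using u' st(1) by simp
  have "conn adj C" unfolding C_def by (rule conn_component)
  from at_dist_next[OF this st(2) i]
  have y: "?y \<in> C" "adj (last L) ?y" "(edge_in adj C ^^ dist_target L C) ?y s"
    by (simp_all add: at_dist_def s(1))
  have "C' \<subseteq> V - set L'" unfolding C'_def using uL' by (rule component_subset)
  \<comment> \<open>The target still lies in \<open>C'\<close>, so it is not the vertex just added,
    and the old distance is positive.\<close>
  then have "?y \<noteq> s" using s(3) by (auto simp: L'_def)
  then obtain d where d: "dist_target L C = Suc d" using y(3) by (cases "dist_target L C") auto
  obtain w where w: "edge_in adj C ?y w" "(edge_in adj C ^^ d) w s"
    using relpowp_Suc_D2[OF y(3)[unfolded d]] by blast
  have wC: "w \<in> C" "adj ?y w" using w(1) by (auto simp: edge_in_def)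
  have min: "\<not> (edge_in adj C ^^ k) ?y s" if "k \<le> d" for k
  proof
    assume "(edge_in adj C ^^ k) ?y s"
    then have "\<exists>y. at_dist L C k y" using y s(1) by (auto simp: at_dist_def)
    then have "dist_target L C \<le> k" unfolding dist_target_def by (rule Least_le)
    then show False using d that by simp
  qed
  have "C \<subseteq> V - set L" unfolding C_def using st(1) by (rule component_subset)
  then have "C - {?y} \<subseteq> V - set L'" by (auto simp: L'_def)
  from relpow_avoid[OF w(2) s(3)[unfolded C'_def] uL' this wC(1) min]
  have "w \<in> C'" "(edge_in adj C' ^^ d) w s" by (simp_all add: C'_def)
  then have "\<exists>y. at_dist L' C' d y" using wC(2) s(2) by (auto simp: at_dist_def L'_def)
  then have "dist_target L' C' \<le> d" unfolding dist_target_def by (rule Least_le)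
  then show ?thesis using d by simp
qed

lemma covers: "U \<subseteq> VT"
proof
  fix u assume uU: "u \<in> U"
  show "u \<in> VT"
  proof (rule ccontr)
    assume neg: "u \<notin> VT"
    \<comment> \<open>This is the branch followed towards \<open>u\<close>; \<open>C n\<close> is
      the component of \<open>u\<close> beyond its initial part \<open>Ls n\<close>.\<close>
    define Ls where "Ls = rec_nat [root] (\<lambda>_ L. L @ [next_vertex L (component adj (V - set L) u)])"
    define C where "C n = component adj (V - set (Ls n)) u" for n
    have Ls0: "Ls 0 = [root]" and LsSuc: "Ls (Suc n) = Ls n @ [next_vertex (Ls n) (C n)]" for n
      by (simp_all add: Ls_def C_def)
    have notin: "u \<notin> set L" if "pos L" for L using that neg by (auto simp: VT_def)
    have inv: "pos (Ls n) \<and> u \<in> cone (Ls n)" for n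
    proof (induction n)
      case 0
      have "V \<subseteq> component adj V root"
        using connV subset_refl root_in by (rule conn_subset_component)
      then have "u \<in> cone [root]" using uU UV by (auto simp: cone_def)
      then show ?case using pos.root by (simp add: Ls0)
    next
      case (Suc n)
      then have p: "pos (Ls n)" "u \<in> cone (Ls n)" by auto
      have g: "gpath V adj (Ls n)" using pos_gpath p by simp
      have ul: "u \<noteq> last (Ls n)" using notin[OF p(1)] g by (auto simp: gpath_def)
      have "pos (Ls (Suc n))" unfolding LsSuc C_def using p(1) uU p(2) ul by (rule pos.step)
      moreover have "cone (Ls (Suc n)) = C n" unfolding LsSuc C_def by (rule cone_step(6)[OF g p(2) ul])
      then have "u \<in> cone (Ls (Suc n))" by (simp add: C_def)
      ultimately show ?case by simp
    qed
    have g: "gpath V adj (Ls n)" and uc: "u \<in> cone (Ls n)" and ul: "u \<noteq> last (Ls n)"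
      and un: "u \<notin> set (Ls n)" for n
      using inv[of n] pos_gpath[of "Ls n"] notin[of "Ls n"] by (auto simp: gpath_def)
    have uVn: "u \<in> V - set (Ls n)" for n using un uU UV by blast
    have CV: "C n \<subseteq> V - set (Ls n)" for n unfolding C_def by (rule component_subset[OF uVn])
    have len: "length (Ls n) = Suc n" for n by (induction n) (simp_all add: Ls0 LsSuc)
    have Lsle: "\<exists>zs. Ls n = Ls m @ zs" if "m \<le> n" for m n
      using that by (induction rule: dec_induct) (auto simp: LsSuc)
    have mono: "set (Ls m) \<subseteq> set (Ls n)" if "m \<le> n" for m n using Lsle[OF that] by auto
    have Cmono: "C n \<subseteq> C m" if "m \<le> n" for m n
      unfolding C_def by (rule component_mono) (use mono[OF that] in blast)
    define t where "t i = enum i (Ls (fst (prod_decode i)))" for i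
    have t: "enum i (Ls n) = t i" if le: "fst (prod_decode i) \<le> n" for i n
    proof -
      obtain zs where zs: "Ls n = Ls (fst (prod_decode i)) @ zs" using Lsle[OF le] by blast
      then have "take (fst (prod_decode i)) (Ls n) = take (fst (prod_decode i)) (Ls (fst (prod_decode i)))"
        by (simp add: len)
      then show ?thesis by (simp add: t_def enum_def)
    qed
    \<comment> \<open>Once all \<open>t j\<close> with \<open>j < i\<close> have left the components
      \<open>C n\<close>, a vertex \<open>t i\<close> that never leaves would remain the target
      forever, with its distance dropping at each step.\<close>
    have out: "\<exists>n. t i \<notin> C n" for i
    proof (induction i rule: less_induct)
      case (less i)
      show ?case
      proof (rule ccontr)
        assume "\<not> ?case"
        then have stay: "t i \<in> C n" for n by blast
        have "\<forall>j\<in>{..<i}. \<exists>n. t j \<notin> C n" using less by blast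
        from bchoice[OF this] obtain f where f: "\<forall>j\<in>{..<i}. t j \<notin> C (f j)" by (elim exE)
        \<comment> \<open>From \<open>n0\<close> on, all earlier targets have left and the entries
          up to index \<open>i\<close> of the enumeration are stable.\<close>
        define n0 where "n0 = Max (f ` {..<i} \<union> (\<lambda>j. fst (prod_decode j)) ` {..i})"
        have n0: "f j \<le> n0" if "j < i" for j unfolding n0_def using that by (intro Max_ge) auto
        have n0': "fst (prod_decode j) \<le> n0" if "j \<le> i" for j
          unfolding n0_def using that by (intro Max_ge) auto
        have tgt: "target (Ls n) (C n) = t i" and en: "enum i (Ls n) \<in> C n" if n: "n0 \<le> n" for n
        proof -
          have ti: "enum i (Ls n) = t i" using n0'[of i] n by (intro t) simp
          then show en: "enum i (Ls n) \<in> C n" using stay by simp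
          have "(LEAST j. enum j (Ls n) \<in> C n) = i"
          proof (rule Least_equality)
            show "enum i (Ls n) \<in> C n" by (rule en)
          next
            fix j assume j: "enum j (Ls n) \<in> C n"
            show "i \<le> j"
            proof (rule ccontr)
              assume "\<not> i \<le> j"
              then have "j < i" by simp
              then have "t j \<notin> C (f j)" using f by simp
              moreover have "C n \<subseteq> C (f j)" using n0[OF \<open>j < i\<close>] n by (intro Cmono) simp
              moreover have "enum j (Ls n) = t j" using n0'[of j] \<open>j < i\<close> n by (intro t) simp
              ultimately show False using j by auto
            qed
          qed
          then show "target (Ls n) (C n) = t i" using ti by (simp add: target_def)
        qed
        have dec: "dist_target (Ls (Suc n)) (C (Suc n)) < dist_target (Ls n) (C n)" if n: "n0 \<le> n" for n
          using g uc ul C_def LsSuc C_def[of "Suc n"] un en[OF n] tgt[OF n] _ stay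
          by (rule dist_target_decreases) (use n in \<open>simp add: tgt\<close>)
        have "dist_target (Ls (n0 + k)) (C (n0 + k)) + k \<le> dist_target (Ls n0) (C n0)" for k
        proof (induction k)
          case (Suc k)
          then show ?case using dec[of "n0 + k"] by simp
        qed simp
        from this[of "Suc (dist_target (Ls n0) (C n0))"] show False by simp
      qed
    qed
    define M where "M = \<Union>(K ` lists (\<Union>n. set (Ls n)))"
    have Mt: "\<exists>i. z = t i" if zM: "z \<in> M" for z
    proof -
      obtain xs where xs: "set xs \<subseteq> (\<Union>n. set (Ls n))" "z \<in> K xs" using zM by (auto simp: M_def)
      obtain k where k: "set xs \<subseteq> set (Ls k)"
        using finite_subset_increasing_UN[of "set xs" "\<lambda>n. set (Ls n)", OF _ xs(1) mono] by auto
      \<comment> \<open>\<open>Ls k\<close> has \<open>Suc k\<close> entries, so the index has to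
        encode \<open>Suc k\<close> rather than \<open>k\<close>.\<close>
      have tk: "take (Suc k) (Ls (Suc k)) = Ls k" using len[of k] by (simp add: LsSuc)
      have "z \<in> K (Ls k)" using K_mono[OF k] xs(2) by blast
      then obtain m where "from_nat_into (K (Ls k)) m = z"
        using from_nat_into_surj[OF K_countable] by blast
      then have "t (prod_encode (Suc k, m)) = z" by (simp add: t_def enum_def tk)
      then show ?thesis by blast
    qed
    have LM: "set (Ls n) \<subseteq> M" for n
    proof
      fix x assume "x \<in> set (Ls n)"
      then have "[x] \<in> lists (\<Union>n. set (Ls n))" "x \<in> K [x]" using K_superset[of "[x]"] by auto
      then show "x \<in> M" unfolding M_def by blast
    qed
    have uM: "u \<notin> M"
    proof
      assume "u \<in> M"
      then obtain i where "u = t i" using Mt by blast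
      then obtain n where "u \<notin> C n" using out by blast
      then show False by (simp add: C_def)
    qed
    then have uVM: "u \<in> V - M" using uU UV by blast
    define D where "D = component adj (V - M) u"
    have DM: "D \<subseteq> V - M" unfolding D_def using uVM by (rule component_subset)
    have DC: "D \<subseteq> C n" for n unfolding D_def C_def by (rule component_mono) (use LM in blast)
    have "closed_under K M" unfolding M_def by (rule K_closed)
    then have fin: "finite (nbrs_in adj M D)" unfolding D_def using uU uVM by (rule finite_adhesion)
    \<comment> \<open>A vertex of \<open>M\<close> adjacent to \<open>D\<close> has left some
      \<open>C n\<close>, although \<open>D \<subseteq> C n\<close>; so it must be one of the
      deleted vertices of \<open>Ls n\<close>.\<close>
    have "nbrs_in adj M D \<subseteq> (\<Union>n. set (Ls n))"
    proof
      fix x assume "x \<in> nbrs_in adj M D"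
      then obtain y where xy: "x \<in> M" "y \<in> D" "adj x y" by (auto simp: nbrs_in_def)
      obtain i where "x = t i" using Mt[OF xy(1)] by blast
      then obtain n where n: "x \<notin> C n" using out by blast
      have "x \<in> set (Ls n)"
      proof (rule ccontr)
        assume "x \<notin> set (Ls n)"
        then have x: "x \<in> V - set (Ls n)" using adj_V(1)[OF xy(3)] by simp
        have y: "y \<in> component adj (V - set (Ls n)) u" using DC[of n] xy(2) unfolding C_def by blast
        have "x \<in> C n" unfolding C_def by (rule component_step[of y]) (fact y, fact sym[OF xy(3)], fact x, fact uVn)
        then show False using n by simp
      qed
      then show "x \<in> (\<Union>n. set (Ls n))" by blast
    qed
    with fin have "\<exists>n. nbrs_in adj M D \<subseteq> set (Ls n)"
      by (rule finite_subset_increasing_UN) (rule mono)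
    then obtain n where n: "nbrs_in adj M D \<subseteq> set (Ls n)" by (elim exE)
    \<comment> \<open>All neighbours of \<open>D\<close> in \<open>M\<close> lie on
      \<open>Ls n\<close>, so deleting \<open>Ls n\<close> confines \<open>D\<close> as well as
      deleting \<open>M\<close> does.\<close>
    have "C n \<subseteq> D" unfolding C_def
    proof (rule component_least)
      show "u \<in> D" by (simp add: D_def)
      fix y z assume yz: "y \<in> D" "adj y z" "z \<in> V - set (Ls n)"
      have "z \<notin> M" using n yz(1,3) sym[OF yz(2)] by (auto simp: nbrs_in_def)
      then have "z \<in> V - M" using yz(3) by simp
      then show "z \<in> D"
        using component_step[of y adj "V - M" u z] yz(1,2) uVM unfolding D_def by blast
    qed
    moreover have "next_vertex (Ls n) (C n) \<in> C n" unfolding C_def by (rule cone_step(3)[OF g uc ul])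
    moreover have "next_vertex (Ls n) (C n) \<in> M" using LM[of "Suc n"] by (simp add: LsSuc)
    ultimately show False using DM by blast
  qed
qed

lemma normally_spanned: "normally_spanned V adj U"
  unfolding normally_spanned_def using normal_tree_VT covers by blast

end

section \<open>Branch sets and the tree order\<close>

text \<open>An arbitrary well-order of \<open>A\<close> breaks ties in the lexicographic order that
  compares values of \<open>f\<close> first.\<close>

lemma well_order_on_refining:
  fixes f :: "'b \<Rightarrow> nat"
  shows "\<exists>r. well_order_on A r \<and> (\<forall>x y. (x, y) \<in> r \<longrightarrow> f x \<le> f y)"
proof -
  obtain s where s: "well_order_on A s" using well_order_on[of A] by (elim exE)
  then have lin: "s \<subseteq> A \<times> A" "\<And>x. x \<in> A \<Longrightarrow> (x, x) \<in> s" "trans s" "antisym s"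
    "\<And>x y. x \<in> A \<Longrightarrow> y \<in> A \<Longrightarrow> x \<noteq> y \<Longrightarrow> (x, y) \<in> s \<or> (y, x) \<in> s"
    by (auto simp: well_order_on_def linear_order_on_def partial_order_on_def preorder_on_def
        refl_on_def total_on_def)
  define r where "r = {(x, y). x \<in> A \<and> y \<in> A \<and> (f x < f y \<or> f x = f y \<and> (x, y) \<in> s)}"
  have "trans r" unfolding r_def
    by (rule transI) (auto dest: transD[OF lin(3)])
  moreover have "antisym r" unfolding r_def
    by (rule antisymI) (auto dest: antisymD[OF lin(4)])
  moreover have "total_on A r" unfolding r_def total_on_def using lin(5) by fastforce
  moreover have "refl_on A r" "r \<subseteq> A \<times> A" unfolding r_def refl_on_def using lin(2) by auto
  moreover have "wf (r - Id)"
  proof (rule wf_subset)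
    have "wf (s - Id)" using s by (simp add: well_order_on_def)
    then show "wf (inv_image (less_than <*lex*> (s - Id)) (\<lambda>x. (f x, x)))"
      by (intro wf_inv_image wf_lex_prod wf_less_than)
    show "r - Id \<subseteq> inv_image (less_than <*lex*> (s - Id)) (\<lambda>x. (f x, x))"
      by (auto simp: r_def)
  qed
  ultimately have "well_order_on A r"
    by (simp add: well_order_on_def linear_order_on_def partial_order_on_def preorder_on_def)
  moreover have "\<forall>x y. (x, y) \<in> r \<longrightarrow> f x \<le> f y" by (auto simp: r_def)
  ultimately show ?thesis by blast
qed

section \<open>Least elements of connected sets in a normal tree\<close>

locale rooted_normal_tree =
  fixes V :: "'a set" and adj :: "'a \<Rightarrow> 'a \<Rightarrow> bool" and VT adjT r
  assumes graph: "graph V adj" and normal: "normal_tree V adj VT adjT r"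
begin

lemma sym: "adj x y \<Longrightarrow> adj y x"
  using graph by (auto simp: graph_def)

lemma tree: "is_tree VT adjT" "r \<in> VT"
  using normal by (auto simp: normal_tree_def subtree_def)

lemma adjT_VT: "adjT x y \<Longrightarrow> x \<in> VT \<and> y \<in> VT"
  using tree(1) by (auto simp: is_tree_def graph_def)

definition root_path :: "'a \<Rightarrow> 'a list" where
  "root_path x = (THE p. gpath VT adjT p \<and> hd p = r \<and> last p = x)"

definition below :: "'a \<Rightarrow> 'a \<Rightarrow> bool" where "below x y \<longleftrightarrow> x \<in> set (root_path y)"

definition height :: "'a \<Rightarrow> nat" where "height x = length (root_path x)"

lemma root_path:
  assumes "x \<in> VT"
  shows "gpath VT adjT (root_path x)" "hd (root_path x) = r" "last (root_path x) = x" "root_path x \<noteq> []"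
proof -
  have "\<exists>!p. gpath VT adjT p \<and> hd p = r \<and> last p = x"
    using tree assms unfolding is_tree_def by blast
  from theI'[OF this] show "gpath VT adjT (root_path x)" "hd (root_path x) = r" "last (root_path x) = x"
    unfolding root_path_def by auto
  then show "root_path x \<noteq> []" by (auto simp: gpath_def)
qed

lemma root_path_eq:
  assumes "gpath VT adjT p" "hd p = r"
  shows "root_path (last p) = p"
proof -
  have "last p \<in> VT" using assms(1) by (auto simp: gpath_def)
  then have "\<exists>!p'. gpath VT adjT p' \<and> hd p' = r \<and> last p' = last p"
    using tree unfolding is_tree_def by blast
  then show ?thesis unfolding root_path_def by (rule the1_equality) (use assms in simp)
qed

lemma tree_le_below: "y \<in> VT \<Longrightarrow> tree_le VT adjT r x y \<longleftrightarrow> below x y"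
  unfolding tree_le_def below_def using root_path root_path_eq by metis

lemma below_prefix:
  assumes "y \<in> VT" "below x y"
  shows "x \<in> VT" "prefix (root_path x) (root_path y)"
proof -
  note y = root_path[OF assms(1)]
  obtain ps qs where s: "root_path y = ps @ x # qs"
    using assms(2) by (meson below_def split_list)
  then have "gpath VT adjT ((ps @ [x]) @ qs)" using y(1) by simp
  then have g: "gpath VT adjT (ps @ [x])" by (rule gpath_appendD1) simp
  then show "x \<in> VT" by (simp add: gpath_def)
  have "hd (ps @ [x]) = r" using y(2) s by (cases ps) auto
  from root_path_eq[OF g this] have "root_path x = ps @ [x]" by simp
  then show "prefix (root_path x) (root_path y)" using s by (simp add: prefix_def)
qed

lemma below_refl: "x \<in> VT \<Longrightarrow> below x x"
  unfolding below_def using root_path(3,4) last_in_set by metis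

lemma below_trans: "z \<in> VT \<Longrightarrow> below y z \<Longrightarrow> below x y \<Longrightarrow> below x z"
  using below_prefix(2)[of z y] unfolding below_def by (auto dest: set_mono_prefix)

lemma prefix_below: "x \<in> VT \<Longrightarrow> prefix (root_path x) (root_path y) \<Longrightarrow> below x y"
  using below_refl unfolding below_def by (auto dest: set_mono_prefix)

lemma below_linear:
  assumes "z \<in> VT" "below x z" "below y z"
  shows "below x y \<or> below y x"
proof -
  note x = below_prefix[OF assms(1,2)] and y = below_prefix[OF assms(1,3)]
  from prefix_same_cases[OF x(2) y(2)] show ?thesis using prefix_below x(1) y(1) by blast
qed

lemma below_height:
  assumes "y \<in> VT" "below x y"
  shows "height x \<le> height y" "height x = height y \<Longrightarrow> x = y"
proof -
  note x = below_prefix[OF assms]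
  then obtain zs where zs: "root_path y = root_path x @ zs" by (auto simp: prefix_def)
  then show "height x \<le> height y" by (simp add: height_def)
  assume "height x = height y"
  then have "root_path y = root_path x" using zs by (simp add: height_def)
  then show "x = y" using root_path(3)[OF x(1)] root_path(3)[OF assms(1)] by simp
qed

text \<open>If \<open>y\<close> is not on the root path of \<open>x\<close>, appending it gives the
  root path of \<open>y\<close>.\<close>

lemma adjT_comparable:
  assumes "adjT x y"
  shows "below x y \<or> below y x"
proof (cases "below y x")
  case False
  note x = root_path[of x] and xy = adjT_VT[OF assms]
  have "gpath VT adjT (root_path x @ [y])"
    using x xy assms False by (intro gpath_append) (auto simp: gpath_single below_def)
  moreover have "hd (root_path x @ [y]) = r" using x xy by simp
  ultimately have "root_path y = root_path x @ [y]" using root_path_eq by fastforce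
  then show ?thesis using prefix_below[of x y] xy by (simp add: prefix_def)
qed simp

lemma tpath_comparable:
  assumes "tpath V adj VT adjT p"
  shows "below (hd p) (last p) \<or> below (last p) (hd p)"
proof -
  have "hd p \<in> VT" "last p \<in> VT" using assms by (auto simp: tpath_def)
  moreover have "tree_le VT adjT r (hd p) (last p) \<or> tree_le VT adjT r (last p) (hd p)"
    using normal assms by (auto simp: normal_tree_def)
  ultimately show ?thesis using tree_le_below by blast
qed

text \<open>Unless its ends are joined by a tree edge, the segment is a \<open>T\<close>-path: a
  tree edge on it has both ends in \<open>VT\<close>, while inner vertices are outside, so the
  segment would consist of that edge alone.\<close>

lemma segment_comparable:
  assumes p: "gpath V adj p" and ki: "k < i" "i < length p" "p ! k \<in> VT" "p ! i \<in> VT"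
    and inner: "\<And>j. k < j \<Longrightarrow> j < i \<Longrightarrow> p ! j \<notin> VT"
  shows "below (p ! k) (p ! i) \<or> below (p ! i) (p ! k)"
proof (cases "adjT (p ! k) (p ! i)")
  case True
  then show ?thesis by (rule adjT_comparable)
next
  case False
  define q where "q = take (Suc (i - k)) (drop k p)"
  have len: "length q = Suc (i - k)" using ki by (simp add: q_def)
  have nth: "q ! j = p ! (k + j)" if "j \<le> i - k" for j using that ki by (simp add: q_def)
  have ne: "q \<noteq> []" "drop k p \<noteq> []" using len ki by auto
  have "gpath V adj (take k p @ drop k p)" using p by simp
  then have "gpath V adj (drop k p)" using ne(2) by (rule gpath_appendD2)
  then have "gpath V adj (q @ drop (Suc (i - k)) (drop k p))"
    unfolding q_def by (simp only: append_take_drop_id)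
  then have q: "gpath V adj q" using ne(1) by (rule gpath_appendD1)
  have hd: "hd q = p ! k" using nth[of 0] ne by (simp add: hd_conv_nth)
  have last: "last q = p ! i" using nth[of "i - k"] ne len ki by (simp add: last_conv_nth)
  have inn: "q ! j \<notin> VT" if "0 < j" "Suc j < length q" for j
    using that inner[of "k + j"] nth[of j] len ki(1) by simp
  have "\<not> adjT (q ! j) (q ! Suc j)" if j: "Suc j < length q" for j
  proof
    assume "adjT (q ! j) (q ! Suc j)"
    then have T: "q ! j \<in> VT" "q ! Suc j \<in> VT" using adjT_VT by auto
    have "j = 0" using T(1) inn[of j] j by (cases j) auto
    moreover have "Suc (Suc j) = length q" using T(2) inn[of "Suc j"] j by (cases "Suc (Suc j) = length q") auto
    ultimately have "i = Suc k" using len ki(1) by simp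
    then have "adjT (p ! k) (p ! i)"
      using \<open>adjT (q ! j) (q ! Suc j)\<close> \<open>j = 0\<close> nth[of 0] nth[of 1] by simp
    then show False using False by simp
  qed
  then have "tpath V adj VT adjT q"
    unfolding tpath_def using q len ki hd last inn by auto
  from tpath_comparable[OF this] show ?thesis unfolding hd last .
qed

text \<open>A vertex \<open>m\<close> of minimal height is least. Along a path in \<open>X\<close>
  starting at \<open>m\<close>, consecutive tree vertices are comparable. If the next one lies below
  its predecessor, it is comparable with \<open>m\<close>, as both are below the predecessor; being
  below \<open>m\<close> would make it equal to \<open>m\<close> by minimality.\<close>

lemma conn_has_least:
  assumes X: "X \<subseteq> V" "conn adj X" "X \<inter> VT \<noteq> {}"
  shows "\<exists>m\<in>X \<inter> VT. \<forall>x\<in>X \<inter> VT. below m x"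
proof -
  obtain x0 where "x0 \<in> X \<inter> VT" using X(3) by blast
  from ex_has_least_nat[of "\<lambda>x. x \<in> X \<inter> VT", OF this, of height]
  obtain m where m: "m \<in> X \<inter> VT" "\<forall>y. y \<in> X \<inter> VT \<longrightarrow> height m \<le> height y" by blast
  have "below m x" if x: "x \<in> X \<inter> VT" for x
  proof -
    have "(edge_in adj X)\<^sup>*\<^sup>* m x" using X(2) m(1) x unfolding conn_def by blast
    moreover have "m \<in> X" using m(1) by simp
    ultimately obtain p where p: "gpath X adj p" "hd p = m" "last p = x" by (rule reach_gpath)
    have ne: "p \<noteq> []" and pX: "set p \<subseteq> X" using p(1) by (auto simp: gpath_def)
    have pV: "gpath V adj p" using p(1) X(1) by (rule gpath_mono)
    have "below m (p ! i)" if "i < length p" "p ! i \<in> VT" for i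
      using that
    proof (induction i rule: less_induct)
      case (less i)
      show ?case
      proof (cases "i = 0")
        case True
        then show ?thesis using p(2) ne m(1) below_refl by (simp add: hd_conv_nth)
      next
        case False
        define k where "k = Max {k. k < i \<and> p ! k \<in> VT}"
        have fin: "finite {k. k < i \<and> p ! k \<in> VT}" by simp
        have "p ! 0 \<in> VT" using p(2) ne m(1) by (simp add: hd_conv_nth)
        then have "0 \<in> {k. k < i \<and> p ! k \<in> VT}" using False by simp
        then have "k \<in> {k. k < i \<and> p ! k \<in> VT}" unfolding k_def using fin by (intro Max_in) auto
        then have k: "k < i" "p ! k \<in> VT" by auto
        have inner: "p ! j \<notin> VT" if "k < j" "j < i" for j
        proof
          assume "p ! j \<in> VT"
          then have "j \<le> k" unfolding k_def using fin that(2) by (intro Max_ge) simp_all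
          then show False using that(1) by simp
        qed
        have IH: "below m (p ! k)" using less.IH[OF k(1)] k less.prems by simp
        from segment_comparable[OF pV k(1) less.prems(1) k(2) less.prems(2) inner]
        show ?thesis
        proof
          assume "below (p ! k) (p ! i)"
          then show ?thesis using below_trans less.prems(2) IH by blast
        next
          assume "below (p ! i) (p ! k)"
          from below_linear[OF k(2) IH this] show ?thesis
          proof
            assume b: "below (p ! i) m"
            have "p ! i \<in> X \<inter> VT" using less.prems pX by auto
            then have "height m \<le> height (p ! i)" using m(2) by blast
            moreover have "m \<in> VT" using m(1) by simp
            ultimately have "p ! i = m" using below_height[OF _ b] by simp
            then show ?thesis using below_refl m(1) by simp
          qed
        qed
      qed
    qed
    from this[of "length p - 1"] show ?thesis using p(3) ne x by (simp add: last_conv_nth)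
  qed
  then show ?thesis using m(1) by blast
qed

text \<open>For adjacent \<open>X\<close> and \<open>Y\<close> the connected set
  \<open>X \<union> Y\<close> has a least element, which forces \<open>m X\<close> and
  \<open>m Y\<close> to be comparable. Ordered by height, the earlier neighbours of \<open>X\<close>
  thus have their least elements on the finite root path of \<open>m X\<close>, and these elements
  are distinct because branch sets are disjoint.\<close>

lemma minor_countable_colouring_number:
  assumes "U \<subseteq> VT" and minor: "minor_of V adj HV adjH" and rooted: "rooted_minor U HV"
  shows "countable_colouring_number HV adjH"
proof -
  have HV: "X \<subseteq> V" "conn adj X" "X \<inter> VT \<noteq> {}" if "X \<in> HV" for X
  proof -
    show "X \<subseteq> V" "conn adj X" using that minor by (simp_all add: minor_of_def connected_in_iff)
    show "X \<inter> VT \<noteq> {}" using that rooted assms(1) unfolding rooted_minor_def by blast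
  qed
  have "\<forall>X\<in>HV. \<exists>m. m \<in> X \<inter> VT \<and> (\<forall>x\<in>X \<inter> VT. below m x)"
  proof
    fix X assume "X \<in> HV"
    from conn_has_least[OF HV[OF this]] show "\<exists>m. m \<in> X \<inter> VT \<and> (\<forall>x\<in>X \<inter> VT. below m x)"
      unfolding Bex_def .
  qed
  from bchoice[OF this] obtain m
    where m0: "\<forall>X\<in>HV. m X \<in> X \<inter> VT \<and> (\<forall>x\<in>X \<inter> VT. below (m X) x)" by (elim exE)
  have m: "m X \<in> X" "m X \<in> VT" "\<And>x. x \<in> X \<Longrightarrow> x \<in> VT \<Longrightarrow> below (m X) x" if "X \<in> HV" for X
    using m0 that by auto
  have comparable: "below (m X) (m Y) \<or> below (m Y) (m X)" if XY: "adjH X Y" for X Y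
  proof -
    have H: "X \<in> HV" "Y \<in> HV" "\<exists>x\<in>X. \<exists>y\<in>Y. adj x y"
      using minor XY by (auto simp: minor_of_def graph_def)
    from H(3) obtain x y where xy: "x \<in> X" "y \<in> Y" "adj x y" by (elim bexE)
    have "conn adj (X \<union> Y)"
      by (rule conn_Un_edge[OF _ HV(2)[OF H(1)] HV(2)[OF H(2)] xy]) (rule sym)
    moreover have "X \<union> Y \<subseteq> V" using HV(1) H by blast
    moreover have "(X \<union> Y) \<inter> VT \<noteq> {}" using HV(3)[OF H(1)] by blast
    ultimately obtain n where n: "n \<in> X \<union> Y" "n \<in> VT" "\<forall>x\<in>(X \<union> Y) \<inter> VT. below n x"
      using conn_has_least[of "X \<union> Y"] by blast
    have nX: "below n (m X)" and nY: "below n (m Y)" using n(3) m(1,2) H(1,2) by auto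
    from n(1) show ?thesis
    proof
      assume "n \<in> X"
      then have "below (m X) n" using m(3)[OF H(1)] n(2) by blast
      then show ?thesis using below_trans[OF m(2)[OF H(2)] nY] by blast
    next
      assume "n \<in> Y"
      then have "below (m Y) n" using m(3)[OF H(2)] n(2) by blast
      then show ?thesis using below_trans[OF m(2)[OF H(1)] nX] by blast
    qed
  qed
  have inj: "inj_on m HV"
  proof (rule inj_onI)
    fix X Y assume XY: "X \<in> HV" "Y \<in> HV" "m X = m Y"
    then have "m X \<in> X \<inter> Y" using m(1)[of X] m(1)[of Y] by simp
    then show "X = Y" using minor XY(1,2) unfolding minor_of_def by blast
  qed
  obtain s where s: "well_order_on HV s" "\<forall>X Y. (X, Y) \<in> s \<longrightarrow> height (m X) \<le> height (m Y)"
    using well_order_on_refining[of HV "\<lambda>X. height (m X)"] by blast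
  have "finite {Y. adjH Y X \<and> Y \<noteq> X \<and> (Y, X) \<in> s}" if X: "X \<in> HV" for X
  proof (rule inj_on_finite)
    have sub: "{Y. adjH Y X \<and> Y \<noteq> X \<and> (Y, X) \<in> s} \<subseteq> HV"
      using minor by (auto simp: minor_of_def graph_def)
    then show "inj_on m {Y. adjH Y X \<and> Y \<noteq> X \<and> (Y, X) \<in> s}" using inj by (rule inj_on_subset[rotated])
    show "finite (set (root_path (m X)))" by simp
    show "m ` {Y. adjH Y X \<and> Y \<noteq> X \<and> (Y, X) \<in> s} \<subseteq> set (root_path (m X))"
    proof
      fix z assume "z \<in> m ` {Y. adjH Y X \<and> Y \<noteq> X \<and> (Y, X) \<in> s}"
      then obtain Y where Y: "z = m Y" "adjH Y X" "(Y, X) \<in> s" "Y \<in> HV" using sub by blast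
      have le: "height (m Y) \<le> height (m X)" using s(2) Y(3) by blast
      have "below (m Y) (m X)"
        using comparable[OF Y(2)]
      proof
        assume b: "below (m X) (m Y)"
        then have "m X = m Y" using below_height[OF m(2)[OF Y(4)] b] le by simp
        then show ?thesis using b by simp
      qed
      then show "z \<in> set (root_path (m X))" by (simp add: below_def Y(1))
    qed
  qed
  then show ?thesis unfolding countable_colouring_number_def using s(1) by blast
qed

end

theorem theorem6p1:
  fixes V :: "'a set" and adj :: "'a \<Rightarrow> 'a \<Rightarrow> bool" and U :: "'a set"
  assumes "graph V adj" and "connected_in V adj V" and "U \<subseteq> V"
  shows "normally_spanned V adj U \<longleftrightarrow>
    (\<forall>HV adjH. minor_of V adj HV adjH \<and> rooted_minor U HV \<and> countable_branch_sets HV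
       \<longrightarrow> countable_colouring_number HV adjH)"
proof
  assume "normally_spanned V adj U"
  then obtain VT adjT r where T: "normal_tree V adj VT adjT r" "U \<subseteq> VT"
    by (auto simp: normally_spanned_def)
  interpret rooted_normal_tree V adj VT adjT r
    by unfold_locales (fact assms(1), fact T(1))
  show "\<forall>HV adjH. minor_of V adj HV adjH \<and> rooted_minor U HV \<and> countable_branch_sets HV
       \<longrightarrow> countable_colouring_number HV adjH"
    using minor_countable_colouring_number[OF T(2)] by blast
next
  assume col: "\<forall>HV adjH. minor_of V adj HV adjH \<and> rooted_minor U HV \<and> countable_branch_sets HV
       \<longrightarrow> countable_colouring_number HV adjH"
  interpret colourable_minors V adj U
    by unfold_locales (use assms(1) col in blast)+
  obtain K :: "'a list \<Rightarrow> 'a set" where K: "(\<forall>xs. countable (K xs)) \<and> (\<forall>xs. set xs \<subseteq> K xs) \<and>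
    (\<forall>xs ys. set xs \<subseteq> set ys \<longrightarrow> K xs \<subseteq> K ys) \<and> (\<forall>S. closed_under K (\<Union>(K ` lists S))) \<and>
    (\<forall>M u. closed_under K M \<longrightarrow> u \<in> U \<longrightarrow> u \<in> V - M \<longrightarrow>
      finite (nbrs_in adj M (component adj (V - M) u)))"
    using finite_adhesion_closure by (elim exE)
  interpret adhesion_closure V adj U K
  proof
    show "conn adj V" using assms(2) by (simp add: connected_in_iff)
  qed (use assms K in simp_all)
  show "normally_spanned V adj U" by (rule normally_spanned)
qed

end
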